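(* Let $n\ge2$ and suppose that $\widetilde G=K_n$ (i.e. $\tilde g_{ij}=1$ for all $i\neq j$). Let $\lambda_2$ be the second smallest eigenvalue (with multiplicity) of the Laplacian $L$ of $G$. Then full revelation is optimal if and only if $\beta\le\widehat\beta(\lambda_2)$, where $\widehat\beta(\lambda)\equiv\frac{1}{2(n-\lambda)}$ for $\lambda<n$ and $\widehat\beta(n)=\infty$.
   Context: Model. There are one principal and $n$ agents. Agent $i$ chooses $a_i\in\mathbb R$; $\mathbf a=(a_1,\dots,a_n)'$. The state $\mathbf x=(x_1,\dots,x_n)'$ is distributed as $N(\mu\mathbf 1_n,\sigma^2 I_n)$, with $\mu\in\mathbb R$, $\sigma^2>0$, $\mathbf 1_n$ the vector of ones. The incentive graph $G=[g_{ij}]$ and the synergy graph $\widetilde G=[\tilde g_{ij}]$ are symmetric $n\times n$ matrices with entries in $\{0,1\}$ and zero diagonal; $\beta\ge0$ is a parameter. Agent $i$'s payoff is $u_i(\mathbf a,\mathbf x)=-(a_i-x_i)^2-\beta\sum_{j} g_{ij}(a_i-a_j)^2$; the principal's payoff is $v(\mathbf a,\mathbf x)=-\sum_i (a_i-x_i)^2-\beta\sum_i\sum_j\tilde g_{ij}(a_i-a_j)^2$. A public signal is a map (Markov kernel) $\varphi:\mathbb R^n\to\Delta(M)$, $M$ a measurable space. All agents observe the realization $m$ and nothing else, form $\hat{\mathbf x}=\mathbb E[\mathbf x\mid m]$, and play the unique Nash equilibrium $\mathbf a^*=B\hat{\mathbf x}$, $B=(I_n+\beta L)^{-1}$, where $L=D_G-G$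 and $\widetilde L=D_{\widetilde G}-\widetilde G$ are the graph Laplacians ($D$ the diagonal degree matrix). Then $\mathbb E[v(\mathbf a^*,\mathbf x)]=-\mathbb E[\mathbf x'\mathbf x]+\mathbb E[\hat{\mathbf x}'V\hat{\mathbf x}]$ with $V=B'(I_n-2\beta(\widetilde L-L))B$. A signal is optimal if it maximizes $\mathbb E[v(\mathbf a^*,\mathbf x)]$ (equivalently $\mathbb E[\hat{\mathbf x}'V\hat{\mathbf x}]$) over all public signals. Full revelation is the signal $m=\mathbf x$. All eigenvalues of the Laplacian of a graph on $n$ vertices lie in $[0,n]$. *)

theory Defs
  imports "HOL-Probability.Probability" "HOL-Computational_Algebra.Polynomial"
begin

section \<open>Graphs and their Laplacians\<close>

definition is_graph :: "real ^ 'n ^ 'n \<Rightarrow> bool" where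
  "is_graph G \<longleftrightarrow> transpose G = G \<and> (\<forall>i j. G $ i $ j \<in> {0, 1}) \<and> (\<forall>i. G $ i $ i = 0)"

definition complete_adjacency :: "real ^ 'n ^ 'n" where
  "complete_adjacency = (\<chi> i j. if i = j then 0 else 1)"

definition laplacian :: "real ^ 'n ^ 'n \<Rightarrow> real ^ 'n ^ 'n" where
  "laplacian G = (\<chi> i j. if i = j then (\<Sum>k\<in>UNIV. G $ i $ k) else 0) - G"

definition charpoly :: "real ^ 'n ^ 'n \<Rightarrow> real poly" where
  "charpoly A = det (mat [:0, 1:] - (\<chi> i j. [:A $ i $ j:]))"

text \<open>
  The list of real eigenvalues in increasing order, each repeated according to its algebraic
  multiplicity. For a symmetric matrix it has length \<open>CARD('n)\<close>.
\<close>

definition sorted_eigenvalues :: "real ^ 'n ^ 'n \<Rightarrow> real list" where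
  "sorted_eigenvalues A = sorted_list_of_multiset (proots (charpoly A))"

section \<open>Payoffs and equilibrium\<close>

definition agent_payoff ::
  "real \<Rightarrow> real ^ 'n ^ 'n \<Rightarrow> 'n \<Rightarrow> real ^ 'n \<Rightarrow> real ^ 'n \<Rightarrow> real" where
  "agent_payoff \<beta> G i a x =
     - (a $ i - x $ i)\<^sup>2 - \<beta> * (\<Sum>j\<in>UNIV. G $ i $ j * (a $ i - a $ j)\<^sup>2)"

definition principal_payoff ::
  "real \<Rightarrow> real ^ 'n ^ 'n \<Rightarrow> real ^ 'n \<Rightarrow> real ^ 'n \<Rightarrow> real" where
  "principal_payoff \<beta> Gs a x =
     - (\<Sum>i\<in>UNIV. (a $ i - x $ i)\<^sup>2)
     - \<beta> * (\<Sum>i\<in>UNIV. \<Sum>j\<in>UNIV. Gs $ i $ j * (a $ i - a $ j)\<^sup>2)"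

definition response_matrix :: "real \<Rightarrow> real ^ 'n ^ 'n \<Rightarrow> real ^ 'n ^ 'n" where
  "response_matrix \<beta> G = matrix_inv (mat 1 + \<beta> *\<^sub>R laplacian G)"

text \<open>
  Nash equilibria of the game in which the agents share the belief \<open>P\<close> about the state.
  Lemma \<open>nash_iff_response\<close> below shows that the equilibrium is unique and is obtained by
  applying \<open>response_matrix\<close> to the mean of \<open>P\<close>.
\<close>

definition nash ::
  "real \<Rightarrow> real ^ 'n ^ 'n \<Rightarrow> (real ^ 'n) measure \<Rightarrow> real ^ 'n \<Rightarrow> bool" where
  "nash \<beta> G P a \<longleftrightarrow>
     (\<forall>i b. (\<integral>x. agent_payoff \<beta> G i (\<chi> k. if k = i then b else a $ k) x \<partial>P)
            \<le> (\<integral>x. agent_payoff \<beta> G i a x \<partial>P))"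

lemma quadratic_nonneg_iff:
  fixes K d :: real
  assumes "K > 0"
  shows "(\<forall>t. 0 \<le> K * t\<^sup>2 + 2 * t * d) \<longleftrightarrow> d = 0"
proof
  assume "\<forall>t. 0 \<le> K * t\<^sup>2 + 2 * t * d"
  then have "0 \<le> K * (- d / K)\<^sup>2 + 2 * (- d / K) * d" by blast
  also have "\<dots> = - (d\<^sup>2 / K)" using assms by (simp add: power2_eq_square field_simps)
  finally have "d\<^sup>2 / K \<le> 0" by simp
  then show "d = 0" using assms by (simp add: divide_le_0_iff)
qed (use assms in simp)

lemma laplacian_mult:
  "((mat 1 + \<beta> *\<^sub>R laplacian G) *v a) $ i
   = a $ i + \<beta> * (\<Sum>j\<in>UNIV. G $ i $ j * (a $ i - a $ j))"
proof -
  have 1: "(laplacian G *v a) $ i = (\<Sum>j\<in>UNIV. G $ i $ j * (a $ i - a $ j))"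
  proof -
    have "(laplacian G *v a) $ i
        = (\<Sum>j\<in>UNIV. (if i = j then (\<Sum>k\<in>UNIV. G $ i $ k) * a $ j else 0) - G $ i $ j * a $ j)"
      unfolding laplacian_def matrix_vector_mult_def
      by (auto intro!: sum.cong simp: left_diff_distrib)
    also have "\<dots> = (\<Sum>k\<in>UNIV. G $ i $ k) * a $ i - (\<Sum>j\<in>UNIV. G $ i $ j * a $ j)"
      by (simp add: sum_subtractf)
    finally show ?thesis
      by (simp add: right_diff_distrib sum_subtractf sum_distrib_right)
  qed
  show ?thesis
    by (simp add: matrix_vector_mult_add_rdistrib scaleR_matrix_vector_assoc[symmetric] 1)
qed

lemma invertible_response:
  fixes G :: "real ^ 'n ^ 'n"
  assumes G: "is_graph G" and \<beta>: "\<beta> \<ge> 0"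
  shows "invertible (mat 1 + \<beta> *\<^sub>R laplacian G)"
proof -
  have sym: "G $ i $ j = G $ j $ i" for i j
    using G unfolding is_graph_def by (metis transpose_def vec_lambda_beta)
  have nonneg: "G $ i $ j \<ge> 0" for i j
  proof -
    have "G $ i $ j \<in> {0, 1}" using G unfolding is_graph_def by blast
    then show ?thesis by auto
  qed
  have "a = 0" if a: "(mat 1 + \<beta> *\<^sub>R laplacian G) *v a = 0" for a :: "real ^ 'n"
  proof -
    let ?S = "\<Sum>i\<in>UNIV. \<Sum>j\<in>UNIV. G $ i $ j * (a $ i * (a $ i - a $ j))"
    have S2: "?S = (\<Sum>i\<in>UNIV. \<Sum>j\<in>UNIV. G $ i $ j * (a $ j * (a $ j - a $ i)))"
      by (subst sum.swap) (simp add: sym)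
    have "2 * ?S = (\<Sum>i\<in>UNIV. \<Sum>j\<in>UNIV. G $ i $ j * (a $ i - a $ j)\<^sup>2)"
      unfolding mult_2 by (subst (2) S2)
        (simp add: sum.distrib[symmetric] power2_eq_square algebra_simps)
    also have "\<dots> \<ge> 0" by (intro sum_nonneg mult_nonneg_nonneg nonneg) simp
    finally have S: "?S \<ge> 0" by simp
    have "0 = (\<Sum>i\<in>UNIV. a $ i * ((mat 1 + \<beta> *\<^sub>R laplacian G) *v a) $ i)" using a by simp
    also have "\<dots> = (\<Sum>i\<in>UNIV. (a $ i)\<^sup>2) + \<beta> * ?S"
      unfolding laplacian_mult
      by (simp add: distrib_left sum.distrib power2_eq_square sum_distrib_left mult_ac)
    finally have "(\<Sum>i\<in>UNIV. (a $ i)\<^sup>2) \<le> 0" using S \<beta>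
      by (smt (verit) mult_nonneg_nonneg)
    moreover have "(\<Sum>i\<in>UNIV. (a $ i)\<^sup>2) \<ge> 0" by (simp add: sum_nonneg)
    ultimately have "(\<Sum>i\<in>UNIV. (a $ i)\<^sup>2) = 0" by simp
    then show ?thesis by (simp add: sum_nonneg_eq_0_iff vec_eq_iff)
  qed
  then show ?thesis
    using invertible_left_inverse matrix_left_invertible_ker by blast
qed

lemma nash_iff_response:
  fixes G :: "real ^ 'n ^ 'n" and P :: "(real ^ 'n) measure"
  assumes G: "is_graph G" and \<beta>: "\<beta> \<ge> 0"
    and P: "prob_space P" "\<And>i. integrable P (\<lambda>x. x $ i)" "\<And>i. integrable P (\<lambda>x. (x $ i)\<^sup>2)"
  shows "nash \<beta> G P a \<longleftrightarrow> a = response_matrix \<beta> G *v (\<chi> i. \<integral>x. x $ i \<partial>P)"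
proof -
  interpret prob_space P by (rule P)
  let ?y = "\<chi> i. \<integral>x. x $ i \<partial>P"
  let ?A = "mat 1 + \<beta> *\<^sub>R laplacian G"
  have G0: "G $ i $ i = 0" for i using G by (simp add: is_graph_def)
  have Gn: "G $ i $ j \<ge> 0" for i j
  proof -
    have "G $ i $ j \<in> {0, 1}" using G unfolding is_graph_def by blast
    then show ?thesis by auto
  qed
  have payoff: "(\<integral>x. agent_payoff \<beta> G i c x \<partial>P)
      = - ((c $ i)\<^sup>2 - 2 * c $ i * ?y $ i + (\<integral>x. (x $ i)\<^sup>2 \<partial>P))
        - \<beta> * (\<Sum>j\<in>UNIV. G $ i $ j * (c $ i - c $ j)\<^sup>2)" for i c
  proof -
    have "(\<integral>x. agent_payoff \<beta> G i c x \<partial>P)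
      = (\<integral>x. 2 * c $ i * x $ i - (x $ i)\<^sup>2
           - ((c $ i)\<^sup>2 + \<beta> * (\<Sum>j\<in>UNIV. G $ i $ j * (c $ i - c $ j)\<^sup>2)) \<partial>P)"
      by (intro Bochner_Integration.integral_cong)
         (simp_all add: agent_payoff_def power2_diff algebra_simps)
    also have "\<dots> = 2 * c $ i * ?y $ i - (\<integral>x. (x $ i)\<^sup>2 \<partial>P)
           - ((c $ i)\<^sup>2 + \<beta> * (\<Sum>j\<in>UNIV. G $ i $ j * (c $ i - c $ j)\<^sup>2))"
      using P by (simp add: prob_space)
    finally show ?thesis by simp
  qed
  have dev: "(\<forall>b. (\<integral>x. agent_payoff \<beta> G i (\<chi> k. if k = i then b else a $ k) x \<partial>P)
                 \<le> (\<integral>x. agent_payoff \<beta> G i a x \<partial>P))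
             \<longleftrightarrow> (?A *v a) $ i = ?y $ i" for i
  proof -
    define K where "K = 1 + \<beta> * (\<Sum>j\<in>UNIV. G $ i $ j)"
    define d where "d = (?A *v a) $ i - ?y $ i"
    have K: "K > 0" unfolding K_def using \<beta> Gn
      by (smt (verit) mult_nonneg_nonneg sum_nonneg)
    have diff: "(\<integral>x. agent_payoff \<beta> G i a x \<partial>P)
        - (\<integral>x. agent_payoff \<beta> G i (\<chi> k. if k = i then b else a $ k) x \<partial>P)
        = K * (b - a $ i)\<^sup>2 + 2 * (b - a $ i) * d" for b
    proof -
      have "(\<Sum>j\<in>UNIV. G $ i $ j * (b - (if j = i then b else a $ j))\<^sup>2)
          = (\<Sum>j\<in>UNIV. G $ i $ j * (b - a $ j)\<^sup>2)"
        by (intro sum.cong) (auto simp: G0)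
      also have "\<dots> = (\<Sum>j\<in>UNIV. G $ i $ j * (a $ i - a $ j)\<^sup>2
            + (b - a $ i)\<^sup>2 * G $ i $ j + 2 * (b - a $ i) * (G $ i $ j * (a $ i - a $ j)))"
        by (intro sum.cong) (auto simp: power2_eq_square algebra_simps)
      also have "\<dots> = (\<Sum>j\<in>UNIV. G $ i $ j * (a $ i - a $ j)\<^sup>2)
            + (b - a $ i)\<^sup>2 * (\<Sum>j\<in>UNIV. G $ i $ j)
            + 2 * (b - a $ i) * (\<Sum>j\<in>UNIV. G $ i $ j * (a $ i - a $ j))"
        by (simp add: sum.distrib sum_distrib_left)
      finally have expand: "(\<Sum>j\<in>UNIV. G $ i $ j * (b - (if j = i then b else a $ j))\<^sup>2)
          = (\<Sum>j\<in>UNIV. G $ i $ j * (a $ i - a $ j)\<^sup>2)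
            + (b - a $ i)\<^sup>2 * (\<Sum>j\<in>UNIV. G $ i $ j)
            + 2 * (b - a $ i) * (\<Sum>j\<in>UNIV. G $ i $ j * (a $ i - a $ j))" .
      define S where "S = (\<Sum>j\<in>UNIV. G $ i $ j * (a $ i - a $ j)\<^sup>2)"
      define T where "T = (\<Sum>j\<in>UNIV. G $ i $ j)"
      define R where "R = (\<Sum>j\<in>UNIV. G $ i $ j * (a $ i - a $ j))"
      have e1: "(\<integral>x. agent_payoff \<beta> G i (\<chi> k. if k = i then b else a $ k) x \<partial>P)
          = - (b\<^sup>2 - 2 * b * ?y $ i + (\<integral>x. (x $ i)\<^sup>2 \<partial>P))
            - \<beta> * (S + (b - a $ i)\<^sup>2 * T + 2 * (b - a $ i) * R)"
        unfolding payoff S_def T_def R_def expand[symmetric] by simp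
      have e2: "(\<integral>x. agent_payoff \<beta> G i a x \<partial>P)
          = - ((a $ i)\<^sup>2 - 2 * a $ i * ?y $ i + (\<integral>x. (x $ i)\<^sup>2 \<partial>P)) - \<beta> * S"
        unfolding payoff S_def by simp
      have e3: "K = 1 + \<beta> * T" by (simp add: K_def T_def)
      have e4: "d = a $ i + \<beta> * R - ?y $ i"
        unfolding d_def laplacian_mult R_def by simp
      show ?thesis
        unfolding e1 e2 e3 e4 by (simp add: power2_eq_square algebra_simps)
    qed
    have "(\<forall>b. (\<integral>x. agent_payoff \<beta> G i (\<chi> k. if k = i then b else a $ k) x \<partial>P)
                 \<le> (\<integral>x. agent_payoff \<beta> G i a x \<partial>P))
        \<longleftrightarrow> (\<forall>b. 0 \<le> K * (b - a $ i)\<^sup>2 + 2 * (b - a $ i) * d)"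
      unfolding diff[symmetric] by simp
    also have "\<dots> \<longleftrightarrow> (\<forall>t. 0 \<le> K * t\<^sup>2 + 2 * t * d)"
    proof (intro iffI allI)
      fix t assume "\<forall>b. 0 \<le> K * (b - a $ i)\<^sup>2 + 2 * (b - a $ i) * d"
      from spec[OF this, of "t + a $ i"] show "0 \<le> K * t\<^sup>2 + 2 * t * d" by simp
    next
      fix b assume "\<forall>t. 0 \<le> K * t\<^sup>2 + 2 * t * d"
      from spec[OF this, of "b - a $ i"]
      show "0 \<le> K * (b - a $ i)\<^sup>2 + 2 * (b - a $ i) * d" .
    qed
    also have "\<dots> \<longleftrightarrow> d = 0" by (rule quadratic_nonneg_iff[OF K])
    finally show ?thesis by (simp add: d_def)
  qed
  have inv_eqs: "?A ** matrix_inv ?A = mat 1" "matrix_inv ?A ** ?A = mat 1"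
    using someI_ex[OF invertible_response[OF G \<beta>, unfolded invertible_def]]
    unfolding matrix_inv_def by simp_all
  have "nash \<beta> G P a \<longleftrightarrow> ?A *v a = ?y"
    unfolding nash_def dev by (simp add: vec_eq_iff)
  also have "\<dots> \<longleftrightarrow> a = matrix_inv ?A *v ?y"
  proof
    assume "?A *v a = ?y"
    then have "matrix_inv ?A *v ?y = (matrix_inv ?A ** ?A) *v a"
      by (simp only: matrix_vector_mul_assoc[symmetric])
    then show "a = matrix_inv ?A *v ?y" by (simp only: inv_eqs matrix_vector_mul_lid)
  next
    assume "a = matrix_inv ?A *v ?y"
    then have "?A *v a = (?A ** matrix_inv ?A) *v ?y"
      by (simp only: matrix_vector_mul_assoc)
    then show "?A *v a = ?y" by (simp only: inv_eqs matrix_vector_mul_lid)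
  qed
  finally show ?thesis by (simp add: response_matrix_def)
qed

section \<open>State, public signals and optimality\<close>

text \<open>The law \<open>N(\<mu> 1, \<sigma>\<^sup>2 I)\<close>; \<open>normal_density\<close> takes the standard deviation.\<close>

definition state_law :: "real \<Rightarrow> real \<Rightarrow> (real ^ 'n) measure" where
  "state_law \<mu> \<sigma> = density lborel (\<lambda>x. ennreal (\<Prod>i\<in>UNIV. normal_density \<mu> \<sigma> (x $ i)))"

definition public_signal :: "'m measure \<Rightarrow> (real ^ 'n \<Rightarrow> 'm measure) \<Rightarrow> bool" where
  "public_signal M \<phi> \<longleftrightarrow> \<phi> \<in> borel \<rightarrow>\<^sub>M prob_algebra M"

text \<open>Joint law of the pair (state, message).\<close>

definition joint_law ::
  "real \<Rightarrow> real \<Rightarrow> 'm measure \<Rightarrow> (real ^ 'n \<Rightarrow> 'm measure) \<Rightarrow> ((real ^ 'n) \<times> 'm) measure" where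
  "joint_law \<mu> \<sigma> M \<phi> =
     bind (state_law \<mu> \<sigma>) (\<lambda>x. distr (\<phi> x) (borel \<Otimes>\<^sub>M M) (\<lambda>m. (x, m)))"

text \<open>
  The conditional expectation of the state given the message, i.e. given the sigma-algebra
  generated by the second coordinate.
\<close>

definition posterior_mean ::
  "real \<Rightarrow> real \<Rightarrow> 'm measure \<Rightarrow> (real ^ 'n \<Rightarrow> 'm measure) \<Rightarrow> (real ^ 'n) \<times> 'm \<Rightarrow> real ^ 'n" where
  "posterior_mean \<mu> \<sigma> M \<phi> \<omega> =
     (\<chi> i. real_cond_exp (joint_law \<mu> \<sigma> M \<phi>)
             (vimage_algebra (space (joint_law \<mu> \<sigma> M \<phi>)) snd M) (\<lambda>\<omega>'. fst \<omega>' $ i) \<omega>)"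

definition signal_value ::
  "real \<Rightarrow> real \<Rightarrow> real \<Rightarrow> real ^ 'n ^ 'n \<Rightarrow> real ^ 'n ^ 'n \<Rightarrow>
   'm measure \<Rightarrow> (real ^ 'n \<Rightarrow> 'm measure) \<Rightarrow> real" where
  "signal_value \<mu> \<sigma> \<beta> G Gs M \<phi> =
     (\<integral>\<omega>. principal_payoff \<beta> Gs (response_matrix \<beta> G *v posterior_mean \<mu> \<sigma> M \<phi> \<omega>) (fst \<omega>)
        \<partial>joint_law \<mu> \<sigma> M \<phi>)"

text \<open>
  HOL cannot quantify over all types inside a formula, so the competing message spaces \<open>N\<close> are
  all measurable spaces over a type \<open>'k\<close> passed as a parameter. Taking \<open>'k\<close> to be
  \<open>(real ^ 'n) + 'm\<close> with \<open>'m\<close> a free type variable covers every measurable space over every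
  type, and always includes a copy of the state space.
\<close>

definition optimal_signal ::
  "'k itself \<Rightarrow> real \<Rightarrow> real \<Rightarrow> real \<Rightarrow> real ^ 'n ^ 'n \<Rightarrow> real ^ 'n ^ 'n \<Rightarrow>
   'm measure \<Rightarrow> (real ^ 'n \<Rightarrow> 'm measure) \<Rightarrow> bool" where
  "optimal_signal (_ :: 'k itself) \<mu> \<sigma> \<beta> G Gs M \<phi> \<longleftrightarrow>
     public_signal M \<phi> \<and>
     (\<forall>(N :: 'k measure) \<psi>. public_signal N \<psi> \<longrightarrow>
        signal_value \<mu> \<sigma> \<beta> G Gs N \<psi> \<le> signal_value \<mu> \<sigma> \<beta> G Gs M \<phi>)"

text \<open>The signal \<open>m = x\<close>, with message space \<open>borel :: (real ^ 'n) measure\<close>.\<close>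

definition full_revelation :: "real ^ 'n \<Rightarrow> (real ^ 'n) measure" where
  "full_revelation x = return borel x"

definition beta_hat :: "nat \<Rightarrow> real \<Rightarrow> ereal" where
  "beta_hat n l = (if l < real n then ereal (1 / (2 * (real n - l))) else \<infinity>)"

end

theory Submission
  imports Defs
begin

text \<open>
  Write \<open>B\<close> for the response matrix and \<open>y\<close> for the posterior mean. The principal's loss from
  a signal, compared with full revelation, is the expectation of \<open>q (B (x - y))\<close>, where \<open>q\<close> is
  the quadratic form of \<open>I - 2 \<beta> (Ls - L)\<close> and \<open>Ls\<close>, \<open>L\<close> are the Laplacians of the synergy and
  the incentive graph; the remaining terms are bilinear in \<open>y\<close> and \<open>x - y\<close> and have mean zero.
  So full revelation is optimal if \<open>q\<close> is nonnegative. Otherwise \<open>q (B w) < 0\<close> for some unit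
  vector \<open>w\<close>, and revealing only the projection of the state along \<open>w\<close> is better: the state law
  is invariant under the reflection along \<open>w\<close> about its mean, hence the projection is its own
  posterior mean. For the complete graph \<open>Ls = n I - J\<close> with \<open>J\<close> the all-ones matrix, so in an
  orthonormal eigenbasis of \<open>L\<close> containing the normalised all-ones vector \<open>q\<close> is diagonal with
  entries \<open>1\<close> (on that vector) and \<open>1 - 2 \<beta> (n - \<lambda>)\<close> for the other eigenvalues \<open>\<lambda>\<close>.
\<close>

section \<open>Spectral theorem for symmetric matrices\<close>

lemma symmetric_matrix_inner:
  fixes A :: "real ^ 'n ^ 'n"
  assumes "transpose A = A"
  shows "x \<bullet> (A *v y) = (A *v x) \<bullet> y"
  using dot_lmul_matrix[of x A y] by (simp add: vector_matrix_mult_def[of x A] matrix_vector_mult_def[of A x] assms[unfolded transpose_def vec_eq_iff, simplified] mult.commute)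

text \<open>The Rayleigh quotient attains its maximum \<open>d\<close> on the compact unit sphere of
  \<open>S\<close>, at \<open>u\<close>. The residual \<open>A *v u - d *\<^sub>R u\<close> lies in
  \<open>S\<close>, and perturbing \<open>u\<close> along it has a first-order effect equal to the
  squared norm of the residual. At a maximum this effect is zero.\<close>

lemma symmetric_matrix_eigenvector:
  fixes A :: "real ^ 'n ^ 'n"
  assumes A: "transpose A = A" and S: "subspace S" "\<And>x. x \<in> S \<Longrightarrow> A *v x \<in> S" "S \<noteq> {0}"
  obtains u d where "u \<in> S" "norm u = 1" "A *v u = d *\<^sub>R u"
proof -
  obtain y where y: "y \<in> S" "y \<noteq> 0" using S subspace_0 by blast
  then have "y /\<^sub>R norm y \<in> sphere 0 1 \<inter> S" using S(1) by (simp add: subspace_scale)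
  moreover have "compact (sphere 0 1 \<inter> S)"
    using S(1) by (intro compact_Int_closed closed_subspace compact_sphere)
  moreover have "continuous_on (sphere 0 1 \<inter> S) (\<lambda>x. x \<bullet> (A *v x))"
    by (intro continuous_intros linear_continuous_on_compose[OF continuous_on_id] matrix_vector_mul_linear)
  ultimately obtain u where u: "u \<in> sphere 0 1 \<inter> S"
    and max: "\<And>x. x \<in> sphere 0 1 \<inter> S \<Longrightarrow> x \<bullet> (A *v x) \<le> u \<bullet> (A *v u)"
    using continuous_attains_sup[of "sphere 0 1 \<inter> S" "\<lambda>x. x \<bullet> (A *v x)"] by blast
  define d where "d = u \<bullet> (A *v u)"
  have le: "x \<bullet> (A *v x) \<le> d * (x \<bullet> x)" if "x \<in> S" for x
  proof (cases "x = 0")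
    case False
    have "x /\<^sub>R norm x \<in> sphere 0 1 \<inter> S" using False that S(1) by (simp add: subspace_scale)
    from max[OF this] have "x \<bullet> (A *v x) / (norm x)\<^sup>2 \<le> d"
      by (simp add: d_def matrix_vector_mult_scaleR power2_eq_square divide_simps)
    then show ?thesis using False by (simp add: power2_norm_eq_inner divide_simps mult.commute)
  qed simp
  define v where "v = A *v u - d *\<^sub>R u"
  have v: "v \<in> S" using u S by (simp add: v_def subspace_diff subspace_scale)
  define K where "K = d * (v \<bullet> v) - v \<bullet> (A *v v)"
  have K: "K \<ge> 0" using le[OF v] by (simp add: K_def)
  have uu: "u \<bullet> u = 1" using u by (simp add: norm_eq_1)
  \<comment> \<open>This is \<open>le\<close> at \<open>u + t *\<^sub>R v\<close>, weakened from
    \<open>K\<close> to \<open>K + 1\<close> because \<open>quadratic_nonneg_iff\<close> asks for a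
    strictly positive leading coefficient.\<close>
  have "0 \<le> (K + 1) * t\<^sup>2 + 2 * t * - (v \<bullet> v)" for t
  proof -
    have "u + t *\<^sub>R v \<in> S" using u v S(1) by (simp add: subspace_add subspace_scale)
    from le[OF this] have "0 \<le> K * t\<^sup>2 + 2 * t * - (v \<bullet> (A *v u) - d * (v \<bullet> u))"
      using symmetric_matrix_inner[OF A, of u v]
      by (simp add: K_def matrix_vector_right_distrib matrix_vector_mult_scaleR inner_add_left
          inner_add_right algebra_simps power2_eq_square d_def uu inner_commute)
    also have "v \<bullet> (A *v u) - d * (v \<bullet> u) = v \<bullet> v"
      by (subst (4) v_def) (simp add: inner_diff_right)
    finally show ?thesis using zero_le_power2[of t] unfolding distrib_right by linarith
  qed
  then have "v \<bullet> v = 0" using quadratic_nonneg_iff[of "K + 1" "- (v \<bullet> v)"] K by auto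
  then have "A *v u = d *\<^sub>R u" by (simp add: v_def)
  with u show ?thesis using that by auto
qed

text \<open>By induction on the dimension: split off one eigenvector and continue in its orthogonal
  complement inside \<open>S\<close>, which is again invariant by symmetry. Invariant subspaces are
  allowed so that the result can be applied to the complement of the all-ones vector.\<close>

lemma symmetric_matrix_orthonormal_eigenvectors:
  fixes A :: "real ^ 'n ^ 'n"
  assumes A: "transpose A = A" and S: "subspace S" "\<And>x. x \<in> S \<Longrightarrow> A *v x \<in> S"
  shows "\<exists>U. finite U \<and> card U = dim S \<and> U \<subseteq> S \<and> pairwise orthogonal U
           \<and> (\<forall>u\<in>U. norm u = 1 \<and> (\<exists>d. A *v u = d *\<^sub>R u))"
  using S
proof (induction "dim S" arbitrary: S)
  case 0
  then show ?case by (intro exI[of _ "{}"]) simp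
next
  case (Suc k)
  then have "S \<noteq> {0}" by (metis dim_singleton nat.distinct(1) dim_eq_0 subset_refl)
  with symmetric_matrix_eigenvector[OF A Suc.prems] obtain u d
    where u: "u \<in> S" "norm u = 1" "A *v u = d *\<^sub>R u" by metis
  define T where "T = {y \<in> S. \<forall>x\<in>span {u}. orthogonal x y}"
  have T: "T = S \<inter> {y. orthogonal u y}"
    unfolding T_def by (auto simp: span_singleton orthogonal_def)
  have "dim T + dim (span {u}) = dim S"
    unfolding T_def using u(1) Suc.prems(1)
    by (intro dim_subspace_orthogonal_to_vectors) (auto simp: span_minimal subsetD[OF span_minimal[of "{u}" S]])
  moreover have "dim (span {u}) = 1"
  proof -
    have "u \<noteq> 0" using u(2) by auto
    then show ?thesis by (simp add: dim_singleton)
  qed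
  ultimately have k: "k = dim T" using Suc.hyps(2) by simp
  have 1: "subspace T" unfolding T using Suc.prems(1)
    by (intro subspace_inter subspace_orthogonal_to_vector)
  have 2: "A *v x \<in> T" if "x \<in> T" for x
    using that Suc.prems(2) u(3) symmetric_matrix_inner[OF A, of u x]
    by (auto simp: T orthogonal_def)
  from Suc.hyps(1)[OF k 1 2] obtain U where U: "finite U" "card U = dim T" "U \<subseteq> T"
    "pairwise orthogonal U" "\<And>v. v \<in> U \<Longrightarrow> norm v = 1 \<and> (\<exists>d. A *v v = d *\<^sub>R v)" by blast
  have "u \<notin> U" using U(3) u(2) by (auto simp: T orthogonal_def)
  then show ?case
    using U u k Suc.hyps(2)
    by (intro exI[of _ "insert u U"]) (auto simp: T pairwise_insert orthogonal_commute)
qed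

lemma poly_charpoly: "poly (charpoly A) t = det (mat t - A)"
  unfolding charpoly_def det_def
  by (simp add: poly_sum poly_prod mat_def if_distrib[of "\<lambda>p. poly p t"] cong: if_cong)

lemma sum_singleton_mset:
  "finite S \<Longrightarrow> (\<Sum>i\<in>S. {#f i#}) = image_mset f (mset_set S)"
  by (induction rule: finite_induct) auto

section \<open>Spectrum of a matrix with a given orthonormal eigenbasis\<close>

locale orthonormal_eigenbasis =
  fixes A :: "real ^ 'n ^ 'n" and u :: "'n \<Rightarrow> real ^ 'n" and d :: "'n \<Rightarrow> real"
  assumes orthonormal: "u i \<bullet> u j = (if i = j then 1 else 0)"
    and eigen: "A *v u i = d i *\<^sub>R u i"
begin

lemma orthogonal_matrix_u: "orthogonal_matrix (\<chi> i. u i)"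
proof -
  have "orthogonal_matrix (transpose (\<chi> i. u i))"
    unfolding orthogonal_matrix transpose_transpose using orthonormal
    by (simp add: vec_eq_iff matrix_matrix_mult_def transpose_def mat_def inner_vec_def)
  then show ?thesis by (simp only: orthogonal_matrix_transpose)
qed

text \<open>Parseval's identity: the orthogonal matrix with rows \<open>u i\<close> preserves inner
  products.\<close>

lemma inner_expand: "x \<bullet> y = (\<Sum>i\<in>UNIV. (u i \<bullet> x) * (u i \<bullet> y))"
proof -
  have "orthogonal_transformation ((*v) (\<chi> i. u i))"
    using orthogonal_matrix_u
    by (simp add: orthogonal_transformation_matrix matrix_vector_mul_linear)
  then have "x \<bullet> y = ((\<chi> i. u i) *v x) \<bullet> ((\<chi> i. u i) *v y)"
    by (simp add: orthogonal_transformation_def)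
  then show ?thesis by (simp add: inner_vec_def matrix_vector_mult_def)
qed

text \<open>With \<open>?P\<close> the matrix of eigenvectors, the eigenvector equations read
  \<open>(mat t - A) ** transpose ?P = transpose ?P ** ?D t\<close>. Taking determinants and
  cancelling the nonzero one of \<open>?P\<close> gives equality at every real \<open>t\<close>,
  hence equality of polynomials.\<close>

lemma charpoly_eq: "charpoly A = (\<Prod>i\<in>UNIV. [:- d i, 1:])"
proof -
  let ?P = "\<chi> i. u i" and ?D = "\<lambda>t. (\<chi> i j. if i = j then t - d i else 0) :: real ^ 'n ^ 'n"
  have "poly (charpoly A) t = poly (\<Prod>i\<in>UNIV. [:- d i, 1:]) t" for t
  proof -
    have "((mat t - A) ** transpose ?P) $ i $ j = (transpose ?P ** ?D t) $ i $ j" for i j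
    proof -
      have "((mat t - A) ** transpose ?P) $ i $ j = ((mat t - A) *v u j) $ i"
        by (simp add: matrix_matrix_mult_def matrix_vector_mult_def transpose_def)
      also have "\<dots> = (t - d j) * u j $ i"
        by (simp add: matrix_vector_mult_diff_rdistrib eigen left_diff_distrib)
          (simp add: matrix_vector_mult_def mat_def if_distrib[of "\<lambda>x. x * _"] cong: if_cong)
      also have "\<dots> = (transpose ?P ** ?D t) $ i $ j"
        by (simp add: matrix_matrix_mult_def transpose_def if_distrib[of "\<lambda>x. _ * x"] cong: if_cong)
      finally show ?thesis .
    qed
    then have "(mat t - A) ** transpose ?P = transpose ?P ** ?D t" by (simp add: vec_eq_iff)
    from arg_cong[OF this, of det]
    have "det (mat t - A) * det (transpose ?P) = det (transpose ?P) * det (?D t)"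
      by (simp only: det_mul)
    moreover have "det (transpose ?P) \<noteq> 0"
      using det_orthogonal_matrix[OF orthogonal_matrix_u] by (auto simp: det_transpose)
    ultimately have "det (mat t - A) = det (?D t)" by simp
    also have "\<dots> = (\<Prod>i\<in>UNIV. t - d i)" by (subst det_diagonal) simp_all
    finally show ?thesis by (simp add: poly_charpoly poly_prod)
  qed
  then have "poly (charpoly A) = poly (\<Prod>i\<in>UNIV. [:- d i, 1:])" by (rule ext)
  then show ?thesis by (simp only: poly_eq_poly_eq_iff)
qed

lemma sorted_eigenvalues_eq: "sorted_eigenvalues A = sorted_list_of_multiset (image_mset d (mset_set UNIV))"
proof -
  have "proots (\<Prod>i\<in>UNIV. [:- d i, 1:]) = (\<Sum>i\<in>UNIV. {#d i#})"
    by (subst proots_prod) auto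
  also have "\<dots> = image_mset d (mset_set UNIV)"
    by (rule sum_singleton_mset) simp
  finally show ?thesis by (simp add: sorted_eigenvalues_def charpoly_eq)
qed

end

section \<open>Laplacian eigenvalues and the gap form\<close>

lemma laplacian_nth: "(laplacian G *v a) $ i = (\<Sum>j\<in>UNIV. G $ i $ j * (a $ i - a $ j))"
  using laplacian_mult[of 1 G a i] by (simp add: matrix_vector_mult_add_rdistrib)

lemma laplacian_one: "laplacian G *v 1 = 0"
  by (simp add: vec_eq_iff laplacian_nth)

lemma is_graph_sym: "is_graph G \<Longrightarrow> G $ i $ j = G $ j $ i"
  unfolding is_graph_def by (metis transpose_def vec_lambda_beta)

lemma is_graph_nonneg: "is_graph G \<Longrightarrow> G $ i $ j \<ge> 0"
proof -
  assume "is_graph G"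
  then have "G $ i $ j \<in> {0, 1}" unfolding is_graph_def by blast
  then show ?thesis by auto
qed

lemma transpose_laplacian: "is_graph G \<Longrightarrow> transpose (laplacian G) = laplacian G"
  using is_graph_sym[of G] by (auto simp: laplacian_def transpose_def vec_eq_iff)

text \<open>Exchanging the roles of \<open>i\<close> and \<open>j\<close> gives a second expression
  for the quadratic form, and adding the two completes the squares. The double sum meets each edge
  in both orders, whence the factor 2.\<close>

lemma laplacian_form:
  assumes "is_graph G"
  shows "(\<Sum>i\<in>UNIV. \<Sum>j\<in>UNIV. G $ i $ j * (a $ i - a $ j)\<^sup>2) = 2 * (a \<bullet> (laplacian G *v a))"
proof -
  let ?S = "\<Sum>i\<in>UNIV. \<Sum>j\<in>UNIV. G $ i $ j * (a $ i * (a $ i - a $ j))"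
  have S: "a \<bullet> (laplacian G *v a) = ?S"
    by (simp add: inner_vec_def laplacian_nth sum_distrib_left mult_ac)
  have "?S = (\<Sum>i\<in>UNIV. \<Sum>j\<in>UNIV. G $ i $ j * (a $ j * (a $ j - a $ i)))"
    by (subst sum.swap) (simp add: is_graph_sym[OF assms])
  then have "2 * ?S = ?S + (\<Sum>i\<in>UNIV. \<Sum>j\<in>UNIV. G $ i $ j * (a $ j * (a $ j - a $ i)))" by simp
  also have "\<dots> = (\<Sum>i\<in>UNIV. \<Sum>j\<in>UNIV. G $ i $ j * (a $ i - a $ j)\<^sup>2)"
    by (simp add: sum.distrib[symmetric] power2_eq_square algebra_simps)
  finally show ?thesis by (simp add: S)
qed

lemma is_graph_complete: "is_graph complete_adjacency"
  by (auto simp: is_graph_def complete_adjacency_def transpose_def vec_eq_iff)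

lemma inner_one_one: "(1 :: real ^ 'n) \<bullet> 1 = real CARD('n)"
  by (simp add: inner_vec_def)

lemma complete_laplacian_form:
  fixes a :: "real ^ 'n"
  shows "a \<bullet> (laplacian complete_adjacency *v a) = real CARD('n) * (a \<bullet> a) - (1 \<bullet> a)\<^sup>2"
proof -
  have "(laplacian complete_adjacency *v a) $ i = real CARD('n) * a $ i - 1 \<bullet> a" for i
  proof -
    \<comment> \<open>The diagonal weight may be taken as 1 instead of 0, since its term
      \<open>a $ i - a $ i\<close> vanishes.\<close>
    have "(laplacian complete_adjacency *v a) $ i = (\<Sum>j\<in>UNIV. a $ i - a $ j)"
      unfolding laplacian_nth by (intro sum.cong) (auto simp: complete_adjacency_def)
    then show ?thesis by (simp add: sum_subtractf inner_vec_def)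
  qed
  then have "laplacian complete_adjacency *v a = real CARD('n) *\<^sub>R a - (1 \<bullet> a) *\<^sub>R 1"
    by (simp add: vec_eq_iff)
  then show ?thesis by (simp add: inner_diff_right power2_eq_square inner_commute)
qed

text \<open>The variational description of the second eigenvalue. The all-ones vector has eigenvalue
  0, the least possible because the form is nonnegative, so it accounts for entry 0 of the sorted
  list. The later entries are the eigenvalues on its orthogonal complement, and entry 1 is the least
  of them.\<close>

lemma laplacian_second_eigenvalue:
  fixes G :: "real ^ 'n ^ 'n"
  assumes G: "is_graph G" and n: "CARD('n) \<ge> 2"
  defines "l \<equiv> sorted_eigenvalues (laplacian G) ! 1"
  shows "1 \<bullet> a = 0 \<Longrightarrow> l * (a \<bullet> a) \<le> a \<bullet> (laplacian G *v a)"
    and "\<exists>a\<noteq>0. 1 \<bullet> a = 0 \<and> a \<bullet> (laplacian G *v a) = l * (a \<bullet> a)"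
proof -
  let ?L = "laplacian G" and ?S = "{y :: real ^ 'n. orthogonal 1 y}"
  note L = transpose_laplacian[OF G]
  define e :: "real ^ 'n" where "e = 1 /\<^sub>R sqrt (real CARD('n))"
  have ee: "e \<bullet> e = 1" by (simp add: e_def inner_one_one field_simps)
  have e1: "e \<bullet> x = (1 \<bullet> x) / sqrt (real CARD('n))" for x by (simp add: e_def field_simps)
  have "?L *v x \<in> ?S" if "x \<in> ?S" for x
    using symmetric_matrix_inner[OF L, of 1 x] by (simp add: orthogonal_def laplacian_one)
  from symmetric_matrix_orthonormal_eigenvectors[OF L subspace_orthogonal_to_vector this]
  obtain U where "finite U \<and> card U = dim ?S \<and> U \<subseteq> ?S \<and> pairwise orthogonal U
      \<and> (\<forall>u\<in>U. norm u = 1 \<and> (\<exists>d. ?L *v u = d *\<^sub>R u))" ..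
  then have U: "finite U" "card U = dim ?S" "U \<subseteq> ?S" "pairwise orthogonal U"
    "\<And>u. u \<in> U \<Longrightarrow> norm u = 1 \<and> (\<exists>d. ?L *v u = d *\<^sub>R u)" by simp_all
  have "dim {y \<in> UNIV. \<forall>x\<in>span {1 :: real ^ 'n}. orthogonal x y} + dim (span {1 :: real ^ 'n}) = dim (UNIV :: (real ^ 'n) set)"
    by (intro dim_subspace_orthogonal_to_vectors) auto
  moreover have "{y \<in> UNIV. \<forall>x\<in>span {1 :: real ^ 'n}. orthogonal x y} = ?S"
    by (auto simp: span_singleton orthogonal_def)
  ultimately have dimS: "dim ?S + 1 = CARD('n)"
    by (simp add: dim_singleton)
  have eU: "e \<notin> U" using U(3) ee by (auto simp: orthogonal_def e1)
  \<comment> \<open>The complement has dimension \<open>CARD('n) - 1\<close>, so together with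
    \<open>e\<close> there are exactly enough eigenvectors to be indexed by \<open>'n\<close>, as
    the locale requires.\<close>
  have "card (insert e U) = CARD('n)" using eU U(1,2) dimS by simp
  then obtain h :: "'n \<Rightarrow> real ^ 'n" where h: "bij_betw h UNIV (insert e U)"
    using finite_same_card_bij[of "UNIV :: 'n set" "insert e U"] U(1) by auto
  have hU: "h i = e \<or> h i \<in> U" for i using h by (auto simp: bij_betw_def)
  obtain i0 where i0: "h i0 = e" using h by (metis bij_betw_imp_surj_on imageE insertI1)
  have h_inj: "h i = h j \<longleftrightarrow> i = j" for i j using h by (auto simp: bij_betw_def inj_on_def)
  have "\<exists>d. ?L *v h i = d *\<^sub>R h i" for i
  proof (cases "h i = e")
    case True
    then have "?L *v h i = 0 *\<^sub>R h i" by (simp add: e_def matrix_vector_mult_scaleR laplacian_one)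
    then show ?thesis by blast
  qed (use hU U(5) in blast)
  then obtain d where d: "\<And>i. ?L *v h i = d i *\<^sub>R h i" by metis
  have ort: "h i \<bullet> h j = (if i = j then 1 else 0)" for i j
  proof (cases "i = j")
    case True
    then show ?thesis using hU[of i] U(5)[of "h i"] ee by (auto simp: norm_eq_1)
  next
    case False
    then have "h i \<noteq> h j" by (simp add: h_inj)
    moreover have "e \<bullet> u = 0" "u \<bullet> e = 0" if "u \<in> U" for u
    proof -
      show "e \<bullet> u = 0" using that U(3) by (auto simp: e1 orthogonal_def)
      then show "u \<bullet> e = 0" by (subst inner_commute)
    qed
    moreover have "u \<bullet> v = 0" if "u \<in> U" "v \<in> U" "u \<noteq> v" for u v
      using pairwiseD[OF U(4) that] by (simp add: orthogonal_def)
    ultimately have "h i \<bullet> h j = 0" using hU[of i] hU[of j] by (elim disjE) simp_all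
    then show ?thesis using False by simp
  qed
  interpret orthonormal_eigenbasis ?L h d by standard (fact ort, fact d)
  have d0: "d i0 = 0"
    using d[of i0] ort[of i0 i0] by (simp add: i0 e_def matrix_vector_mult_scaleR laplacian_one)
  have d_nonneg: "d i \<ge> 0" for i
  proof -
    have "d i = h i \<bullet> (?L *v h i)" by (simp add: d ort)
    moreover have "0 \<le> 2 * (h i \<bullet> (?L *v h i))"
      unfolding laplacian_form[OF G, symmetric]
      by (intro sum_nonneg mult_nonneg_nonneg is_graph_nonneg[OF G]) simp
    ultimately show ?thesis by simp
  qed
  define xs where "xs = sorted_list_of_multiset (image_mset d (mset_set (UNIV - {i0})))"
  have set_xs: "set xs = d ` (UNIV - {i0})" by (simp add: xs_def)
  have "mset_set (UNIV :: 'n set) = add_mset i0 (mset_set (UNIV - {i0}))"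
    by (simp add: mset_set.remove)
  then have "sorted_eigenvalues ?L = insort 0 xs"
    by (simp add: sorted_eigenvalues_eq xs_def d0)
  \<comment> \<open>No eigenvalue is negative, so \<open>insort\<close> puts the 0 in front, and
    index 1 of the full list is index 0 of \<open>xs\<close>.\<close>
  also have "\<dots> = 0 # xs" using d_nonneg by (intro insort_is_Cons) (auto simp: set_xs)
  finally have l: "l = xs ! 0" by (simp add: l_def)
  \<comment> \<open>Here \<open>n\<close> being at least 2 enters: otherwise \<open>xs\<close> would
    be empty and \<open>xs ! 0\<close> unspecified.\<close>
  have "UNIV - {i0} \<noteq> {}"
  proof
    assume "UNIV - {i0} = {}"
    then have "(UNIV :: 'n set) = {i0}" by blast
    then have "CARD('n) = card {i0}" by (rule arg_cong)
    with n show False by simp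
  qed
  then have ne: "xs \<noteq> []" using set_xs by auto
  have "l \<in> set xs" using l ne by simp
  then obtain k where k: "k \<noteq> i0" "d k = l" by (auto simp: set_xs)
  have l_le: "l \<le> d i" if "i \<noteq> i0" for i
  proof -
    have "d i \<in> set xs" using that by (auto simp: set_xs)
    moreover have "sorted xs" by (simp add: xs_def)
    ultimately show ?thesis using l ne by (cases xs) auto
  qed
  have "1 \<bullet> h k = 0" using ort[of i0 k] k by (simp add: i0 e1)
  moreover have "h k \<noteq> 0" using ort[of k k] by auto
  ultimately show "\<exists>a\<noteq>0. 1 \<bullet> a = 0 \<and> a \<bullet> (?L *v a) = l * (a \<bullet> a)"
    by (intro exI[of _ "h k"]) (simp add: d k)
  assume a: "1 \<bullet> a = 0"
  then have hi0: "h i0 \<bullet> a = 0" by (simp add: i0 e1)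
  \<comment> \<open>At \<open>i0\<close> the eigenvalue 0 may lie below \<open>l\<close>, but the
    coordinate of \<open>a\<close> there is zero.\<close>
  have "l * (h i \<bullet> a)\<^sup>2 \<le> d i * (h i \<bullet> a)\<^sup>2" for i
  proof (cases "i = i0")
    case False
    then show ?thesis using l_le by (intro mult_right_mono) simp_all
  qed (simp add: hi0)
  then have "(\<Sum>i\<in>UNIV. l * (h i \<bullet> a)\<^sup>2) \<le> (\<Sum>i\<in>UNIV. d i * (h i \<bullet> a)\<^sup>2)" by (rule sum_mono)
  moreover have "a \<bullet> a = (\<Sum>i\<in>UNIV. (h i \<bullet> a)\<^sup>2)"
    by (subst inner_expand) (simp add: power2_eq_square)
  moreover have "a \<bullet> (?L *v a) = (\<Sum>i\<in>UNIV. d i * (h i \<bullet> a)\<^sup>2)"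
    by (subst inner_expand) (simp add: symmetric_matrix_inner[OF L] d power2_eq_square mult_ac)
  ultimately show "l * (a \<bullet> a) \<le> a \<bullet> (?L *v a)" by (simp only: sum_distrib_left)
qed

section \<open>Sign of the gap form for the complete synergy graph\<close>

text \<open>The form \<open>q\<close> of the introductory text; its argument is a difference of two
  equilibrium action profiles.\<close>

definition gap_form :: "real \<Rightarrow> real ^ 'n ^ 'n \<Rightarrow> real ^ 'n ^ 'n \<Rightarrow> real ^ 'n \<Rightarrow> real" where
  "gap_form \<beta> G Gs c =
     c \<bullet> c + 2 * \<beta> * (c \<bullet> (laplacian G *v c)) - 2 * \<beta> * (c \<bullet> (laplacian Gs *v c))"

lemma gap_form_scaleR: "gap_form \<beta> G Gs (t *\<^sub>R c) = t\<^sup>2 * gap_form \<beta> G Gs c"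
  by (simp add: gap_form_def matrix_vector_mult_scaleR power2_eq_square algebra_simps)

text \<open>Both Laplacians kill the all-ones vector, so the form is positive there. On the
  orthogonal complement it is at least \<open>(1 - 2 * \<beta> * (N - l)) * (a \<bullet> a)\<close>,
  with equality at an eigenvector for \<open>l\<close>. Nonnegativity therefore amounts to
  \<open>2 * \<beta> * (N - l) \<le> 1\<close>, which is the threshold condition with the
  denominator cleared.\<close>

lemma gap_form_nonneg_iff:
  fixes G :: "real ^ 'n ^ 'n"
  assumes G: "is_graph G" and n: "CARD('n) \<ge> 2" and \<beta>: "\<beta> \<ge> 0"
  shows "(\<forall>c. gap_form \<beta> G complete_adjacency c \<ge> 0)
    \<longleftrightarrow> ereal \<beta> \<le> beta_hat CARD('n) (sorted_eigenvalues (laplacian G) ! 1)"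
proof -
  define l where "l = sorted_eigenvalues (laplacian G) ! 1"
  define N where "N = real CARD('n)"
  have N: "N > 0" by (simp add: N_def)
  note l_props = laplacian_second_eigenvalue[OF G n, folded l_def]
  have "(\<forall>c. gap_form \<beta> G complete_adjacency c \<ge> 0) \<longleftrightarrow> 2 * \<beta> * (N - l) \<le> 1"
  proof
    assume *: "\<forall>c. gap_form \<beta> G complete_adjacency c \<ge> 0"
    obtain a where a: "a \<noteq> 0" "1 \<bullet> a = 0" "a \<bullet> (laplacian G *v a) = l * (a \<bullet> a)"
      using l_props(2) by blast
    have "0 \<le> gap_form \<beta> G complete_adjacency a" using * by blast
    also have "\<dots> = (1 - 2 * \<beta> * (N - l)) * (a \<bullet> a)"
      by (simp add: gap_form_def complete_laplacian_form a N_def algebra_simps)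
    finally have "0 \<le> (1 - 2 * \<beta> * (N - l)) * (a \<bullet> a)" .
    moreover have "a \<bullet> a > 0" using a(1) by simp
    ultimately show "2 * \<beta> * (N - l) \<le> 1"
      using zero_le_mult_iff[of "1 - 2 * \<beta> * (N - l)" "a \<bullet> a"] by linarith
  next
    assume *: "2 * \<beta> * (N - l) \<le> 1"
    show "\<forall>c. gap_form \<beta> G complete_adjacency c \<ge> 0"
    proof
      fix c :: "real ^ 'n"
      \<comment> \<open>\<open>s\<close> is the average of the coordinates of \<open>c\<close>,
        which makes \<open>a\<close> orthogonal to the all-ones vector.\<close>
      define s where "s = (1 \<bullet> c) / N"
      define a where "a = c - s *\<^sub>R 1"
      have s: "1 \<bullet> c = s * N" using N by (simp add: s_def)
      have a: "1 \<bullet> a = 0" by (simp add: a_def inner_diff_right s inner_one_one N_def)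
      have c: "c = a + s *\<^sub>R 1" by (simp add: a_def)
      have "c \<bullet> c = a \<bullet> a + s\<^sup>2 * N"
        by (simp add: c inner_add_left inner_add_right a inner_commute[of a 1] inner_one_one N_def
            power2_eq_square)
      moreover have "c \<bullet> (laplacian G *v c) = a \<bullet> (laplacian G *v a)"
        using symmetric_matrix_inner[OF transpose_laplacian[OF G], of 1 a]
        by (simp add: c matrix_vector_right_distrib matrix_vector_mult_scaleR laplacian_one inner_add_left)
      ultimately have "gap_form \<beta> G complete_adjacency c
          = s\<^sup>2 * N + a \<bullet> a + 2 * \<beta> * (a \<bullet> (laplacian G *v a)) - 2 * \<beta> * N * (a \<bullet> a)"
        by (simp add: gap_form_def complete_laplacian_form s N_def[symmetric] power2_eq_square algebra_simps)
      moreover have "2 * \<beta> * (l * (a \<bullet> a)) \<le> 2 * \<beta> * (a \<bullet> (laplacian G *v a))"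
        using \<beta> l_props(1)[OF a] by (intro mult_left_mono) auto
      moreover have "(2 * \<beta> * (N - l)) * (a \<bullet> a) \<le> 1 * (a \<bullet> a)"
        using * by (intro mult_right_mono) auto
      moreover have "s\<^sup>2 * N \<ge> 0" using N by simp
      ultimately show "gap_form \<beta> G complete_adjacency c \<ge> 0"
        by (simp add: algebra_simps)
    qed
  qed
  also have "\<dots> \<longleftrightarrow> ereal \<beta> \<le> beta_hat CARD('n) l"
  proof (cases "l < N")
    case True
    then show ?thesis by (simp add: beta_hat_def N_def[symmetric] pos_le_divide_eq mult_ac)
  next
    \<comment> \<open>For \<open>l \<ge> N\<close> the inequality holds for every nonnegative
      \<beta>, in agreement with the value \<infinity> of \<open>beta_hat\<close>.\<close>
    case False
    then have "2 * \<beta> * (N - l) \<le> 0" using \<beta> by (simp add: mult_nonneg_nonpos)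
    then show ?thesis using False by (simp add: beta_hat_def N_def[symmetric])
  qed
  finally show ?thesis by (simp add: l_def)
qed

section \<open>The Gaussian state law\<close>

text \<open>Tonelli for product functions, transported from \<open>Basis\<close> to the index type
  along the bijection from \<open>i\<close> to \<open>axis i 1\<close>.\<close>

lemma nn_integral_lborel_vec_prod:
  fixes f :: "'n::finite \<Rightarrow> real \<Rightarrow> ennreal"
  assumes f: "\<And>i. f i \<in> borel_measurable borel"
  shows "(\<integral>\<^sup>+x. (\<Prod>i\<in>UNIV. f i (x $ i)) \<partial>(lborel :: (real ^ 'n) measure)) = (\<Prod>i\<in>UNIV. \<integral>\<^sup>+t. f i t \<partial>lborel)"
proof -
  let ?h = "\<lambda>i. axis i (1::real) :: real ^ 'n"
  have inj: "inj ?h" by (simp add: inj_on_def axis_eq_axis)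
  have basis: "Basis = range ?h" by (auto simp: Basis_vec_def)
  have "(\<integral>\<^sup>+x. (\<Prod>b\<in>Basis. f (inv ?h b) (x \<bullet> b)) \<partial>(lborel :: (real ^ 'n) measure))
      = (\<Prod>b\<in>(Basis :: (real ^ 'n) set). \<integral>\<^sup>+t. f (inv ?h b) t \<partial>lborel)"
    by (rule nn_integral_lborel_prod) (simp_all add: f)
  then show ?thesis
    by (simp add: basis prod.reindex[OF inj] inv_f_f[OF inj] inner_axis)
qed

lemma nn_integral_lborel_translate:
  fixes f :: "'a::euclidean_space \<Rightarrow> ennreal"
  assumes [measurable]: "f \<in> borel_measurable borel"
  shows "(\<integral>\<^sup>+x. f (c + x) \<partial>lborel) = (\<integral>\<^sup>+x. f x \<partial>lborel)"
  by (subst (2) lborel_distr_plus[of c, symmetric], subst nn_integral_distr) simp_all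

text \<open>
  The library proves this for \<open>real ^ 'n\<close> only when the index type is well-ordered. Here it
  follows from Fubini as in the uniqueness of Haar measure, the unit ball serving as the invariant
  test set.
\<close>

lemma nn_integral_lborel_isometry:
  fixes T :: "'a::euclidean_space \<Rightarrow> 'a" and g :: "'a \<Rightarrow> ennreal"
  assumes T: "linear T" "\<And>x. norm (T x) = norm x" and g[measurable]: "g \<in> borel_measurable borel"
  shows "(\<integral>\<^sup>+x. g (T x) \<partial>lborel) = (\<integral>\<^sup>+x. g x \<partial>lborel)"
proof -
  define b :: "'a \<Rightarrow> ennreal" where "b = indicator (ball 0 1)"
  have [measurable]: "b \<in> borel_measurable borel" unfolding b_def by (intro borel_measurable_indicator) simp
  define V where "V = emeasure lborel (ball (0::'a) 1)"
  have [measurable]: "T \<in> borel_measurable borel"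
    using T(1) by (intro borel_measurable_continuous_onI linear_continuous_on linear_conv_bounded_linear[THEN iffD1])
  have "inj T"
    using T linear_injective_0[of T] by (metis norm_eq_zero)
  then have surj: "surj T" using T(1) linear_injective_imp_surjective by blast
  have V: "(\<integral>\<^sup>+y. b (z - y) \<partial>lborel) = V" for z
  proof -
    have "(\<integral>\<^sup>+y. b (z - y) \<partial>lborel) = (\<integral>\<^sup>+y. indicator (ball z 1) y \<partial>lborel)"
      by (intro nn_integral_cong) (simp add: b_def indicator_def dist_norm norm_minus_commute)
    also have "\<dots> = emeasure lborel (ball z 1)" by simp
    also have "\<dots> = V" by (simp add: V_def emeasure_ball)
    finally show ?thesis .
  qed
  have bT: "b (T x) = b x" for x by (simp add: b_def indicator_def T(2))
  have b_int: "(\<integral>\<^sup>+x. b x \<partial>lborel) = V" by (simp add: b_def V_def)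
  have "V * (\<integral>\<^sup>+x. g x \<partial>lborel) = (\<integral>\<^sup>+x. b (T x) * (\<integral>\<^sup>+y. g (T x + y) \<partial>lborel) \<partial>lborel)"
    by (simp add: bT nn_integral_lborel_translate nn_integral_multc b_int)
  also have "\<dots> = (\<integral>\<^sup>+x. \<integral>\<^sup>+y. b (T x) * g (T x + y) \<partial>lborel \<partial>lborel)"
    by (simp add: nn_integral_cmult)
  also have "\<dots> = (\<integral>\<^sup>+y. \<integral>\<^sup>+x. b (T x) * g (T x + y) \<partial>lborel \<partial>lborel)"
    by (intro lborel_pair.Fubini'[symmetric]) simp
  \<comment> \<open>For fixed \<open>y = T y'\<close>, translating \<open>x\<close> by
    \<open>y'\<close> moves \<open>y\<close> out of the argument of \<open>g\<close> and into that
    of \<open>b\<close>. After the next exchange of integrals, the integral over \<open>y\<close> is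
    the volume of a translated ball, which is \<open>V\<close>.\<close>
  also have "\<dots> = (\<integral>\<^sup>+y. \<integral>\<^sup>+x. b (T x - y) * g (T x) \<partial>lborel \<partial>lborel)"
  proof (rule nn_integral_cong)
    fix y :: 'a
    obtain y' where y': "y = T y'" using surj by auto
    have "(\<integral>\<^sup>+x. b (T x) * g (T x + y) \<partial>lborel)
        = (\<integral>\<^sup>+x. b (T (y' + x) - y) * g (T (y' + x)) \<partial>lborel)"
      by (simp add: y' linear_add[OF T(1)] add.commute)
    also have "\<dots> = (\<integral>\<^sup>+x. b (T x - y) * g (T x) \<partial>lborel)"
      by (rule nn_integral_lborel_translate) measurable
    finally show "(\<integral>\<^sup>+x. b (T x) * g (T x + y) \<partial>lborel) = (\<integral>\<^sup>+x. b (T x - y) * g (T x) \<partial>lborel)" .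
  qed
  also have "\<dots> = (\<integral>\<^sup>+x. \<integral>\<^sup>+y. b (T x - y) * g (T x) \<partial>lborel \<partial>lborel)"
    by (intro lborel_pair.Fubini') simp
  also have "\<dots> = V * (\<integral>\<^sup>+x. g (T x) \<partial>lborel)"
    by (simp add: nn_integral_multc nn_integral_cmult V)
  finally have "V * (\<integral>\<^sup>+x. g x \<partial>lborel) = V * (\<integral>\<^sup>+x. g (T x) \<partial>lborel)" .
  moreover have "V \<noteq> 0" "V \<noteq> \<infinity>"
    using unit_ball_vol_pos[of "real DIM('a)"]
    by (auto simp: V_def emeasure_ball simp del: unit_ball_vol_pos)
  ultimately show ?thesis by (simp add: ennreal_mult_cancel_left)
qed

section \<open>Total mass and second moments of the state law\<close>

lemma sets_state_law [simp, measurable_cong]: "sets (state_law \<mu> \<sigma>) = sets borel"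
  by (simp add: state_law_def)

lemma space_state_law [simp]: "space (state_law \<mu> \<sigma>) = UNIV"
  by (simp add: state_law_def)

lemma measurable_vec_nth [measurable]: "(\<lambda>x. (x :: real ^ 'n) $ i) \<in> borel_measurable borel"
  by (intro borel_measurable_continuous_onI continuous_intros)

lemma prob_space_state_law:
  assumes "\<sigma> > 0"
  shows "prob_space (state_law \<mu> \<sigma> :: (real ^ 'n) measure)"
proof
  have "(\<integral>\<^sup>+t. ennreal (normal_density \<mu> \<sigma> t) \<partial>lborel) = 1"
    using assms by (simp add: nn_integral_eq_integral)
  then have "(\<integral>\<^sup>+x. (\<Prod>i\<in>UNIV. ennreal (normal_density \<mu> \<sigma> (x $ i))) \<partial>(lborel :: (real ^ 'n) measure)) = 1"
    by (subst nn_integral_lborel_vec_prod) simp_all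
  then show "emeasure (state_law \<mu> \<sigma> :: (real ^ 'n) measure) (space (state_law \<mu> \<sigma>)) = 1"
    by (simp add: state_law_def emeasure_density prod_ennreal)
qed

text \<open>The integral factors over the coordinates: coordinate \<open>k\<close> contributes a
  one-dimensional second moment, every other one the total mass 1.\<close>

lemma integrable_state_law_sq:
  assumes \<sigma>: "\<sigma> > 0"
  shows "integrable (state_law \<mu> \<sigma> :: (real ^ 'n) measure) (\<lambda>x. (x $ k)\<^sup>2)"
proof -
  \<comment> \<open>The available moments are central, so \<open>t\<^sup>2\<close> is written as
    \<open>(t - \<mu>)\<^sup>2 + 2 * \<mu> * t - \<mu>\<^sup>2\<close>.\<close>
  have "integrable lborel (\<lambda>t. normal_density \<mu> \<sigma> t * (t - \<mu>)\<^sup>2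
      + 2 * \<mu> * (normal_density \<mu> \<sigma> t * t) - \<mu>\<^sup>2 * normal_density \<mu> \<sigma> t)"
    using \<sigma> by (intro Bochner_Integration.integrable_diff Bochner_Integration.integrable_add
        integrable_mult_right integrable_normal_moment integrable_normal_moment_nz_1 integrable_normal_density)
  then have i: "integrable lborel (\<lambda>t. normal_density \<mu> \<sigma> t * t\<^sup>2)"
    by (simp add: power2_eq_square algebra_simps)
  have fin: "(\<integral>\<^sup>+t. ennreal (normal_density \<mu> \<sigma> t) * (if i = k then ennreal (t\<^sup>2) else 1) \<partial>lborel) < \<infinity>" for i
  proof (cases "i = k")
    case True
    then show ?thesis
      using i by (simp add: integrable_iff_bounded ennreal_mult' abs_mult)
  next
    case False
    then show ?thesis using \<sigma> by (simp add: nn_integral_eq_integral)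
  qed
  have "(\<integral>\<^sup>+x. ennreal ((x $ k)\<^sup>2) \<partial>(state_law \<mu> \<sigma> :: (real ^ 'n) measure))
      = (\<integral>\<^sup>+x. (\<Prod>i\<in>UNIV. ennreal (normal_density \<mu> \<sigma> (x $ i)) * (if i = k then ennreal ((x $ i)\<^sup>2) else 1))
          \<partial>(lborel :: (real ^ 'n) measure))"
    unfolding state_law_def
    by (subst nn_integral_density) (simp_all add: prod.distrib prod_ennreal prod.delta)
  also have "\<dots> = (\<Prod>i\<in>(UNIV :: 'n set). \<integral>\<^sup>+t. ennreal (normal_density \<mu> \<sigma> t) * (if i = k then ennreal (t\<^sup>2) else 1) \<partial>lborel)"
    by (rule nn_integral_lborel_vec_prod) measurable
  also have "\<dots> < \<infinity>"
    using fin by (simp add: ennreal_prod_eq_top less_top[symmetric] less_imp_neq)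
  finally show ?thesis by (intro integrableI_bounded) simp_all
qed

section \<open>Reflection invariance of the state law\<close>

text \<open>For a unit vector \<open>w\<close>, the reflection in the hyperplane through the mean
  that is orthogonal to \<open>w\<close>.\<close>

definition mean_reflection :: "real \<Rightarrow> real ^ 'n \<Rightarrow> real ^ 'n \<Rightarrow> real ^ 'n" where
  "mean_reflection \<mu> w x = x - (2 * ((x - \<mu> *\<^sub>R 1) \<bullet> w)) *\<^sub>R w"

lemma measurable_mean_reflection [measurable]: "mean_reflection \<mu> w \<in> borel_measurable borel"
  unfolding mean_reflection_def by measurable

lemma norm_reflection:
  fixes v w :: "'a::real_inner"
  assumes "norm w = 1"
  shows "norm (v - (2 * (v \<bullet> w)) *\<^sub>R w) = norm v"
proof -
  have "w \<bullet> w = 1" using assms by (simp add: norm_eq_1)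
  then have "(v - (2 * (v \<bullet> w)) *\<^sub>R w) \<bullet> (v - (2 * (v \<bullet> w)) *\<^sub>R w) = v \<bullet> v"
    by (simp add: inner_diff_left inner_diff_right inner_commute[of w v])
  then show ?thesis by (simp add: norm_eq_sqrt_inner)
qed

text \<open>In this form the density visibly depends only on the distance to the mean, so isometries
  fixing the mean preserve it.\<close>

lemma prod_normal_density:
  fixes x :: "real ^ 'n"
  shows "(\<Prod>i\<in>UNIV. normal_density \<mu> \<sigma> (x $ i))
    = (1 / sqrt (2 * pi * \<sigma>\<^sup>2)) ^ CARD('n) * exp (- (norm (x - \<mu> *\<^sub>R 1))\<^sup>2 / (2 * \<sigma>\<^sup>2))"
proof -
  have "(norm (x - \<mu> *\<^sub>R 1))\<^sup>2 = (\<Sum>i\<in>UNIV. (x $ i - \<mu>)\<^sup>2)"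
    unfolding power2_norm_eq_inner inner_vec_def by (simp add: power2_eq_square)
  then have "exp (- (norm (x - \<mu> *\<^sub>R 1))\<^sup>2 / (2 * \<sigma>\<^sup>2)) = (\<Prod>i\<in>UNIV. exp (- (x $ i - \<mu>)\<^sup>2 / (2 * \<sigma>\<^sup>2)))"
    by (simp add: exp_sum[symmetric] sum_negf sum_divide_distrib)
  then show ?thesis
    unfolding normal_density_def prod.distrib prod_constant by (simp only:)
qed

text \<open>The reflection is a linear isometry \<open>T\<close> followed by a translation by
  \<open>c\<close>. Both preserve Lebesgue measure, and the composite preserves the distance to the
  mean and hence the density.\<close>

lemma distr_state_law_mean_reflection:
  fixes w :: "real ^ 'n"
  assumes w: "norm w = 1"
  shows "distr (state_law \<mu> \<sigma>) borel (mean_reflection \<mu> w) = state_law \<mu> \<sigma>"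
proof (rule measure_eqI)
  fix A assume "A \<in> sets (distr (state_law \<mu> \<sigma>) borel (mean_reflection \<mu> w))"
  then have A[measurable]: "A \<in> sets borel" by simp
  define T where "T v = v - (2 * (v \<bullet> w)) *\<^sub>R w" for v
  define c where "c = (2 * \<mu> * (1 \<bullet> w)) *\<^sub>R w"
  define p where "p x = ennreal (\<Prod>i\<in>UNIV. normal_density \<mu> \<sigma> (x $ i))" for x :: "real ^ 'n"
  have [measurable]: "p \<in> borel_measurable borel" unfolding p_def by measurable
  have R: "mean_reflection \<mu> w x = c + T x" for x
    by (simp add: mean_reflection_def c_def T_def inner_diff_left algebra_simps)
  have T: "linear T" "norm (T v) = norm v" for v
    using norm_reflection[OF w] by (auto intro!: linearI simp: T_def inner_add_left algebra_simps)
  have [measurable]: "T \<in> borel_measurable borel" unfolding T_def by measurable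
  have "c + T x - \<mu> *\<^sub>R 1 = T (x - \<mu> *\<^sub>R 1)" for x
    by (simp add: c_def T_def inner_diff_left algebra_simps)
  then have p: "p (c + T x) = p x" for x
    by (simp only: p_def prod_normal_density T(2))
  have "emeasure (distr (state_law \<mu> \<sigma>) borel (mean_reflection \<mu> w)) A
      = (\<integral>\<^sup>+x. indicator A (mean_reflection \<mu> w x) \<partial>state_law \<mu> \<sigma>)"
    by (subst nn_integral_indicator[symmetric], simp, subst nn_integral_distr) simp_all
  also have "\<dots> = (\<integral>\<^sup>+x. p (c + T x) * indicator A (c + T x) \<partial>lborel)"
    unfolding state_law_def p by (subst nn_integral_density) (simp_all add: p_def R)
  also have "\<dots> = (\<integral>\<^sup>+x. p (c + x) * indicator A (c + x) \<partial>lborel)"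
    by (rule nn_integral_lborel_isometry[OF T]) measurable
  also have "\<dots> = (\<integral>\<^sup>+x. p x * indicator A x \<partial>lborel)"
    by (rule nn_integral_lborel_translate) measurable
  also have "\<dots> = emeasure (state_law \<mu> \<sigma>) A"
    by (simp add: state_law_def emeasure_density p_def)
  finally show "emeasure (distr (state_law \<mu> \<sigma>) borel (mean_reflection \<mu> w)) A = emeasure (state_law \<mu> \<sigma>) A" .
qed simp

text \<open>Hyperplanes are Lebesgue null and the law has a density. This serves to show that the
  state has positive variance in every direction.\<close>

lemma AE_state_law_hyperplane:
  fixes w :: "real ^ 'n"
  assumes "w \<noteq> 0"
  shows "AE x in state_law \<mu> \<sigma>. w \<bullet> x \<noteq> b"
proof -
  have "{x. w \<bullet> x = b} \<in> null_sets lebesgue"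
    using assms negligible_hyperplane negligible_iff_null_sets by blast
  moreover have "{x. w \<bullet> x = b} \<in> sets borel" by (intro borel_closed closed_hyperplane)
  ultimately have "{x. w \<bullet> x = b} \<in> null_sets lborel"
    by (simp add: null_sets_def)
  then have "AE x in lborel. w \<bullet> x \<noteq> b" by (rule AE_I') auto
  moreover have m: "(\<lambda>x :: real ^ 'n. ennreal (\<Prod>i\<in>UNIV. normal_density \<mu> \<sigma> (x $ i))) \<in> borel_measurable lborel"
    by simp
  ultimately show ?thesis unfolding state_law_def AE_density[OF m] by (auto elim: eventually_mono)
qed

section \<open>Square-integrable random vectors\<close>

text \<open>Membership in L2. The closure lemmas that follow reduce the integrability of each
  quadratic expression in the payoffs to that of the state and the posterior mean.\<close>

definition sq_integrable :: "'a measure \<Rightarrow> ('a \<Rightarrow> 'b::euclidean_space) \<Rightarrow> bool" where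
  "sq_integrable M f \<longleftrightarrow> f \<in> borel_measurable M \<and> integrable M (\<lambda>x. (norm (f x))\<^sup>2)"

lemma integrable_real_bound:
  fixes f g :: "'a \<Rightarrow> real"
  assumes "integrable M f" "g \<in> borel_measurable M" "\<And>x. \<bar>g x\<bar> \<le> f x"
  shows "integrable M g"
proof (rule Bochner_Integration.integrable_bound[OF assms(1,2)])
  show "AE x in M. norm (g x) \<le> norm (f x)"
    using order_trans[OF assms(3) abs_ge_self] by (intro AE_I2) (simp only: real_norm_def)
qed

lemma sq_integrable_bound:
  assumes "sq_integrable M f" "g \<in> borel_measurable M" "\<And>x. norm (g x) \<le> c * norm (f x)"
  shows "sq_integrable M g"
proof -
  have "\<bar>(norm (g x))\<^sup>2\<bar> \<le> c\<^sup>2 * (norm (f x))\<^sup>2" for x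
    using power_mono[OF assms(3) norm_ge_zero, of x 2] by (simp only: power_mult_distrib abs_power2)
  moreover have "integrable M (\<lambda>x. c\<^sup>2 * (norm (f x))\<^sup>2)" using assms(1) by (simp add: sq_integrable_def)
  moreover have "(\<lambda>x. (norm (g x))\<^sup>2) \<in> borel_measurable M" using assms(2) by measurable
  ultimately have "integrable M (\<lambda>x. (norm (g x))\<^sup>2)" by (rule integrable_real_bound[rotated 2])
  then show ?thesis using assms(2) by (simp add: sq_integrable_def)
qed

lemma sq_integrable_diff:
  assumes "sq_integrable M f" "sq_integrable M g"
  shows "sq_integrable M (\<lambda>x. f x - g x)"
proof -
  have [measurable]: "f \<in> borel_measurable M" "g \<in> borel_measurable M"
    using assms by (auto simp: sq_integrable_def)
  have "\<bar>(norm (f x - g x))\<^sup>2\<bar> \<le> 2 * (norm (f x))\<^sup>2 + 2 * (norm (g x))\<^sup>2" for x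
  proof -
    have "\<bar>(norm (f x - g x))\<^sup>2\<bar> \<le> (norm (f x) + norm (g x))\<^sup>2"
      unfolding abs_power2 by (intro power_mono norm_triangle_ineq4) simp
    also have "\<dots> \<le> 2 * (norm (f x))\<^sup>2 + 2 * (norm (g x))\<^sup>2"
      using zero_le_power2[of "norm (f x) - norm (g x)"] by (simp add: power2_sum power2_diff)
    finally show ?thesis .
  qed
  moreover have "integrable M (\<lambda>x. 2 * (norm (f x))\<^sup>2 + 2 * (norm (g x))\<^sup>2)"
    using assms by (simp add: sq_integrable_def)
  moreover have "(\<lambda>x. (norm (f x - g x))\<^sup>2) \<in> borel_measurable M" by measurable
  ultimately have "integrable M (\<lambda>x. (norm (f x - g x))\<^sup>2)" by (rule integrable_real_bound[rotated 2])
  then show ?thesis by (simp add: sq_integrable_def)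
qed

lemma sq_integrable_inner:
  assumes "sq_integrable M f" "sq_integrable M g"
  shows "integrable M (\<lambda>x. f x \<bullet> g x)"
proof -
  have [measurable]: "f \<in> borel_measurable M" "g \<in> borel_measurable M"
    using assms by (auto simp: sq_integrable_def)
  have "\<bar>f x \<bullet> g x\<bar> \<le> (norm (f x))\<^sup>2 + (norm (g x))\<^sup>2" for x
  proof -
    have "\<bar>f x \<bullet> g x\<bar> \<le> norm (f x) * norm (g x)" by (rule Cauchy_Schwarz_ineq2)
    also have "\<dots> \<le> (norm (f x))\<^sup>2 + (norm (g x))\<^sup>2"
      using zero_le_power2[of "norm (f x) - norm (g x)"] mult_nonneg_nonneg[OF norm_ge_zero norm_ge_zero, of "f x" "g x"]
      unfolding power2_diff mult.assoc by linarith
    finally show ?thesis .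
  qed
  moreover have "integrable M (\<lambda>x. (norm (f x))\<^sup>2 + (norm (g x))\<^sup>2)"
    using assms by (simp add: sq_integrable_def)
  moreover have "(\<lambda>x. f x \<bullet> g x) \<in> borel_measurable M" by measurable
  ultimately show ?thesis by (rule integrable_real_bound[rotated 2])
qed

lemma measurable_matrix_vector_mult [measurable (raw)]:
  fixes f :: "'a \<Rightarrow> real ^ 'n" and A :: "real ^ 'n ^ 'm"
  assumes "f \<in> borel_measurable M"
  shows "(\<lambda>x. A *v f x) \<in> borel_measurable M"
proof -
  have "(*v) A \<in> borel_measurable borel"
    by (intro borel_measurable_continuous_onI linear_continuous_on matrix_vector_mul_bounded_linear)
  with assms show ?thesis by (rule measurable_compose)
qed

lemma sq_integrable_matrix:
  fixes f :: "'a \<Rightarrow> real ^ 'n" and A :: "real ^ 'n ^ 'm"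
  assumes f: "sq_integrable M f"
  shows "sq_integrable M (\<lambda>x. A *v f x)"
proof -
  have A: "bounded_linear ((*v) A)" by (rule matrix_vector_mul_bounded_linear)
  obtain K where K: "\<And>x. norm (A *v x) \<le> norm x * K" using bounded_linear.bounded[OF A] by blast
  have "(\<lambda>x. A *v f x) \<in> borel_measurable M"
    using f by (intro measurable_matrix_vector_mult) (simp add: sq_integrable_def)
  then show ?thesis
    by (rule sq_integrable_bound[OF f, of _ K]) (subst mult.commute, rule K)
qed

lemma sq_integrable_vec:
  fixes f :: "'a \<Rightarrow> real ^ 'n"
  assumes f: "\<And>i. (\<lambda>x. f x $ i) \<in> borel_measurable M" "\<And>i. integrable M (\<lambda>x. (f x $ i)\<^sup>2)"
  shows "sq_integrable M f"
proof -
  have "f \<in> borel_measurable M"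
    using f(1) by (subst borel_measurable_euclidean_space) (auto simp: Basis_vec_def inner_axis)
  moreover have "(\<lambda>x. (norm (f x))\<^sup>2) = (\<lambda>x. \<Sum>i\<in>UNIV. (f x $ i)\<^sup>2)"
    unfolding power2_norm_eq_inner inner_vec_def by (simp add: power2_eq_square)
  ultimately show ?thesis using f(2) by (simp add: sq_integrable_def)
qed

lemma sq_integrable_nth:
  fixes f :: "'a \<Rightarrow> real ^ 'n"
  assumes f: "sq_integrable M f"
  shows "sq_integrable M (\<lambda>x. f x $ i)"
proof -
  have "(\<lambda>x. f x $ i) \<in> borel_measurable M"
    using f measurable_compose[OF _ measurable_vec_nth, of f M i] by (simp add: sq_integrable_def)
  then show ?thesis
    by (rule sq_integrable_bound[OF f, of _ 1]) (simp add: component_le_norm_cart)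
qed

section \<open>Payoff differences\<close>

lemma response_matrix_eq:
  fixes x :: "real ^ 'n"
  assumes "is_graph G" "\<beta> \<ge> 0"
  shows "response_matrix \<beta> G *v x + \<beta> *\<^sub>R (laplacian G *v (response_matrix \<beta> G *v x)) = x"
proof -
  let ?A = "mat 1 + \<beta> *\<^sub>R laplacian G"
  have "?A ** matrix_inv ?A = mat 1"
    using someI_ex[OF invertible_response[OF assms, unfolded invertible_def]]
    unfolding matrix_inv_def by simp
  then have "?A *v (response_matrix \<beta> G *v x) = x"
    by (simp only: response_matrix_def matrix_vector_mul_assoc matrix_vector_mul_lid)
  then show ?thesis
    by (simp only: matrix_vector_mult_add_rdistrib matrix_vector_mul_lid scaleR_matrix_vector_assoc)
qed

lemma principal_payoff_eq:
  assumes "is_graph Gs"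
  shows "principal_payoff \<beta> Gs a x = - ((a - x) \<bullet> (a - x)) - 2 * \<beta> * (a \<bullet> (laplacian Gs *v a))"
  unfolding principal_payoff_def laplacian_form[OF assms] inner_vec_def[of "a - x"]
  by (simp add: power2_eq_square)

text \<open>With \<open>b = B *v y\<close> and \<open>c = B *v (x - y)\<close>, the equilibrium
  equation expresses \<open>x\<close> through \<open>b + c\<close>. Of the difference there remain
  the terms quadratic in \<open>c\<close>, which make up \<open>gap_form\<close>, and the mixed
  terms in \<open>b\<close> and \<open>c\<close>.\<close>

lemma principal_payoff_diff:
  fixes G Gs :: "real ^ 'n ^ 'n" and x y :: "real ^ 'n"
  assumes G: "is_graph G" and Gs: "is_graph Gs" and \<beta>: "\<beta> \<ge> 0"
  defines "B \<equiv> response_matrix \<beta> G"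
  shows "principal_payoff \<beta> Gs (B *v x) x - principal_payoff \<beta> Gs (B *v y) x
    = gap_form \<beta> G Gs (B *v (x - y))
      + (2 * \<beta>) * (((laplacian G - 2 *\<^sub>R laplacian Gs) *v (B *v y)) \<bullet> (B *v (x - y)))"
proof -
  let ?L = "\<lambda>v. laplacian G *v v" and ?M = "\<lambda>v. laplacian Gs *v v"
  define b where "b = B *v y"
  define c where "c = B *v (x - y)"
  have a: "B *v x = b + c"
    unfolding b_def c_def by (simp add: matrix_vector_mult_diff_distrib)
  have x: "x = b + c + \<beta> *\<^sub>R (?L b + ?L c)"
    using response_matrix_eq[OF G \<beta>, of x] a by (simp add: B_def matrix_vector_right_distrib)
  note L = symmetric_matrix_inner[OF transpose_laplacian[OF G]]
  note M = symmetric_matrix_inner[OF transpose_laplacian[OF Gs]]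
  \<comment> \<open>The square \<open>\<beta>\<^sup>2 * (u \<bullet> u)\<close> occurs in both
    adaptation losses and cancels.\<close>
  define u where "u = ?L b + ?L c"
  have 1: "(b + c - x) \<bullet> (b + c - x) = \<beta>\<^sup>2 * (u \<bullet> u)"
    by (simp add: x u_def[symmetric] power2_eq_square)
  have 2: "(b - x) \<bullet> (b - x) = c \<bullet> c + 2 * \<beta> * (c \<bullet> u) + \<beta>\<^sup>2 * (u \<bullet> u)"
    by (simp add: x u_def[symmetric] inner_diff_left inner_diff_right inner_add_left inner_add_right
        inner_commute power2_eq_square algebra_simps)
  have 3: "(b + c) \<bullet> ?M (b + c) = b \<bullet> ?M b + c \<bullet> ?M c + 2 * (?M b \<bullet> c)"
    using M[of c b] M[of b c]
    by (simp add: matrix_vector_right_distrib inner_add_left inner_add_right inner_commute algebra_simps)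
  have 4: "((laplacian G - 2 *\<^sub>R laplacian Gs) *v b) \<bullet> c = ?L b \<bullet> c - 2 * (?M b \<bullet> c)"
    by (simp add: matrix_vector_mult_diff_rdistrib inner_diff_left scaleR_matrix_vector_assoc[symmetric])
  have 5: "c \<bullet> u = c \<bullet> ?L c + ?L b \<bullet> c"
    by (simp add: u_def inner_add_right inner_commute)
  show ?thesis
    unfolding principal_payoff_eq[OF Gs] a b_def[symmetric] c_def[symmetric] 1 2 3 4 5 gap_form_def
    by (simp add: algebra_simps)
qed

section \<open>Public signals\<close>

lemma state_law_in_prob_algebra: "\<sigma> > 0 \<Longrightarrow> state_law \<mu> \<sigma> \<in> space (prob_algebra borel)"
  by (simp add: space_prob_algebra prob_space_state_law)

locale gaussian_signal =
  fixes \<mu> \<sigma> :: real and M :: "'m measure" and \<phi> :: "real ^ 'n \<Rightarrow> 'm measure"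
  assumes \<sigma>: "\<sigma> > 0" and \<phi>: "public_signal M \<phi>"
begin

abbreviation "J \<equiv> joint_law \<mu> \<sigma> M \<phi>"
abbreviation "F \<equiv> vimage_algebra (space J) snd M"
abbreviation "xhat \<equiv> posterior_mean \<mu> \<sigma> M \<phi>"

lemma joint_kernel:
  "(\<lambda>x. distr (\<phi> x) (borel \<Otimes>\<^sub>M M) (\<lambda>m. (x, m))) \<in> borel \<rightarrow>\<^sub>M prob_algebra (borel \<Otimes>\<^sub>M M)"
proof (rule measurable_distr_prob_space2)
  show "\<phi> \<in> borel \<rightarrow>\<^sub>M prob_algebra M" using \<phi> by (simp add: public_signal_def)
  show "(\<lambda>(x, m). (x, m)) \<in> borel \<Otimes>\<^sub>M M \<rightarrow>\<^sub>M borel \<Otimes>\<^sub>M M" by measurable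
qed

lemma sets_J [simp, measurable_cong]: "sets J = sets (borel \<Otimes>\<^sub>M M)"
  unfolding joint_law_def by (rule sets_bind'[OF state_law_in_prob_algebra[OF \<sigma>] joint_kernel])

lemma space_J: "space J = UNIV \<times> space M"
  using sets_eq_imp_space_eq[OF sets_J] by (simp add: space_pair_measure)

lemma prob_space_J: "prob_space J"
  unfolding joint_law_def by (rule prob_space_bind'[OF state_law_in_prob_algebra[OF \<sigma>] joint_kernel])

text \<open>Each kernel keeps the first coordinate at \<open>x\<close>, so its image under
  \<open>fst\<close> is a point mass, and binding with point masses returns the state law.\<close>

lemma distr_J_fst: "distr J borel fst = state_law \<mu> \<sigma>"
proof -
  have "distr (distr (\<phi> x) (borel \<Otimes>\<^sub>M M) (\<lambda>m. (x, m))) borel fst = return borel x" for x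
  proof -
    have "\<phi> x \<in> space (prob_algebra M)"
      using \<phi> by (auto simp: public_signal_def dest: measurable_space)
    then have s: "sets (\<phi> x) = sets M" and p: "prob_space (\<phi> x)" by (auto simp: space_prob_algebra)
    have "(\<lambda>m. (x, m)) \<in> \<phi> x \<rightarrow>\<^sub>M borel \<Otimes>\<^sub>M M"
      by (subst measurable_cong_sets[OF s refl]) simp
    then have "distr (distr (\<phi> x) (borel \<Otimes>\<^sub>M M) (\<lambda>m. (x, m))) borel fst = distr (\<phi> x) borel (\<lambda>m. x)"
      by (subst distr_distr) (simp_all add: comp_def)
    then show ?thesis using prob_space.distr_const[OF p, of x borel] by simp
  qed
  moreover have "(\<lambda>x. distr (\<phi> x) (borel \<Otimes>\<^sub>M M) (\<lambda>m. (x, m))) \<in> state_law \<mu> \<sigma> \<rightarrow>\<^sub>M subprob_algebra (borel \<Otimes>\<^sub>M M)"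
    using measurable_prob_algebraD[OF joint_kernel] by (simp add: measurable_cong_sets[OF sets_state_law refl])
  ultimately have "distr J borel fst = bind (state_law \<mu> \<sigma>) (return borel)"
    unfolding joint_law_def by (subst distr_bind[OF _ _ measurable_fst]) simp_all
  then show ?thesis by (simp add: bind_return'')
qed

lemma fst_measurable [measurable]: "fst \<in> borel_measurable J"
  by (simp add: measurable_cong_sets[OF sets_J refl])

lemma snd_measurable [measurable]: "snd \<in> J \<rightarrow>\<^sub>M M"
  by (simp add: measurable_cong_sets[OF sets_J refl])

lemma subalgebra_F: "subalgebra J F"
  unfolding subalgebra_def
proof
  have "snd \<in> space J \<rightarrow> space M" by (auto simp: space_J)
  then show "sets F \<subseteq> sets J"
    using measurable_sets[OF snd_measurable] by (subst sets_vimage_algebra2) auto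
qed simp

lemma sigma_finite_subalgebra_F: "sigma_finite_subalgebra J F"
proof -
  interpret prob_space J by (rule prob_space_J)
  show ?thesis
    by (intro finite_measure_subalgebra_is_sigma_finite finite_measure_subalgebra.intro
        finite_measure_subalgebra_axioms.intro subalgebra_F finite_measure_axioms)
qed

sublocale prob_space J by (rule prob_space_J)

sublocale sigma_finite_subalgebra J F by (rule sigma_finite_subalgebra_F)

lemma sq_integrable_fst: "sq_integrable J fst"
proof (rule sq_integrable_vec)
  fix i
  show m: "(\<lambda>\<omega>. fst \<omega> $ i) \<in> borel_measurable J" by measurable
  have "integrable (distr J borel fst) (\<lambda>x. (x $ i)\<^sup>2)"
    unfolding distr_J_fst by (rule integrable_state_law_sq[OF \<sigma>])
  then show "integrable J (\<lambda>\<omega>. (fst \<omega> $ i)\<^sup>2)" by (rule integrable_distr[OF fst_measurable])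
qed

lemma sq_integrable_imp_integrable:
  assumes "sq_integrable J (f :: _ \<Rightarrow> real)"
  shows "integrable J f"
proof -
  have "sq_integrable J (\<lambda>_. 1 :: real)" by (simp add: sq_integrable_def)
  from sq_integrable_inner[OF assms this] show ?thesis by simp
qed

lemma integrable_fst_nth: "integrable J (\<lambda>\<omega>. fst \<omega> $ i)"
  by (intro sq_integrable_imp_integrable sq_integrable_nth sq_integrable_fst)

lemma xhat_nth: "xhat \<omega> $ i = real_cond_exp J F (\<lambda>\<omega>'. fst \<omega>' $ i) \<omega>"
  by (simp add: posterior_mean_def)

text \<open>Conditional Jensen for the convex function \<open>t\<^sup>2\<close> carries square
  integrability from the state to its conditional expectation.\<close>

lemma sq_integrable_xhat: "sq_integrable J xhat"
proof (rule sq_integrable_vec)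
  fix i
  show "(\<lambda>\<omega>. xhat \<omega> $ i) \<in> borel_measurable J"
    unfolding xhat_nth by (rule borel_measurable_cond_exp2)
  have "integrable J (\<lambda>\<omega>. (fst \<omega> $ i)\<^sup>2)"
    using sq_integrable_nth[OF sq_integrable_fst, of i] by (simp add: sq_integrable_def)
  then show "integrable J (\<lambda>\<omega>. (xhat \<omega> $ i)\<^sup>2)"
    unfolding xhat_nth
    by (intro integrable_convex_cond_exp[where q = "\<lambda>t. t\<^sup>2" and I = UNIV] integrable_fst_nth)
      (simp_all add: convex_power2)
qed

text \<open>The posterior mean is \<open>F\<close>-measurable, so in its product with
  \<open>fst \<omega> $ j\<close> the latter may be replaced by its conditional expectation under
  the integral.\<close>

lemma xhat_orthogonal: "(\<integral>\<omega>. xhat \<omega> $ i * (fst \<omega> - xhat \<omega>) $ j \<partial>J) = 0"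
proof -
  have 1: "integrable J (\<lambda>\<omega>. xhat \<omega> $ i * fst \<omega> $ j)"
    using sq_integrable_inner[OF sq_integrable_nth[OF sq_integrable_xhat, of i]
        sq_integrable_nth[OF sq_integrable_fst, of j]] by simp
  have 2: "(\<lambda>\<omega>. xhat \<omega> $ i) \<in> borel_measurable F"
    unfolding xhat_nth by (rule borel_measurable_cond_exp)
  have 3: "(\<lambda>\<omega>. fst \<omega> $ j) \<in> borel_measurable J" by measurable
  note c = real_cond_exp_intg[OF 1 2 3, folded xhat_nth]
  show ?thesis
    using c(2) by (simp add: right_diff_distrib Bochner_Integration.integral_diff[OF 1 c(1)])
qed

lemma xhat_orthogonal_matrix: "(\<integral>\<omega>. xhat \<omega> \<bullet> (A *v (fst \<omega> - xhat \<omega>)) \<partial>J) = 0"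
proof -
  have i: "integrable J (\<lambda>\<omega>. xhat \<omega> $ i * (fst \<omega> - xhat \<omega>) $ j)" for i j
    using sq_integrable_inner[OF sq_integrable_nth[OF sq_integrable_xhat, of i]
        sq_integrable_nth[OF sq_integrable_diff[OF sq_integrable_fst sq_integrable_xhat], of j]]
    by (simp only: inner_real_def)
  have "(\<integral>\<omega>. xhat \<omega> \<bullet> (A *v (fst \<omega> - xhat \<omega>)) \<partial>J)
      = (\<integral>\<omega>. (\<Sum>i\<in>UNIV. \<Sum>j\<in>UNIV. A $ i $ j * (xhat \<omega> $ i * (fst \<omega> - xhat \<omega>) $ j)) \<partial>J)"
    by (intro Bochner_Integration.integral_cong refl)
      (simp only: inner_vec_def matrix_vector_mult_def vec_lambda_beta inner_real_def sum_distrib_left mult_ac)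
  also have "\<dots> = (\<Sum>i\<in>UNIV. \<Sum>j\<in>UNIV. A $ i $ j * (\<integral>\<omega>. xhat \<omega> $ i * (fst \<omega> - xhat \<omega>) $ j \<partial>J))"
    using i by (simp only: Bochner_Integration.integral_sum Bochner_Integration.integrable_sum
        integrable_mult_right integral_mult_right_zero)
  finally show ?thesis by (simp only: xhat_orthogonal mult_zero_right sum.neutral_const)
qed

text \<open>Integrate \<open>principal_payoff_diff\<close> with the state as \<open>x\<close> and
  the posterior mean as \<open>y\<close>; the mixed term has mean zero by orthogonality. The first
  integral turns out to be the value of full revelation.\<close>

lemma signal_value_gap:
  assumes G: "is_graph G" and Gs: "is_graph Gs" and \<beta>: "\<beta> \<ge> 0"
  shows "(\<integral>x. principal_payoff \<beta> Gs (response_matrix \<beta> G *v x) x \<partial>state_law \<mu> \<sigma>)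
      - signal_value \<mu> \<sigma> \<beta> G Gs M \<phi>
    = (\<integral>\<omega>. gap_form \<beta> G Gs (response_matrix \<beta> G *v (fst \<omega> - xhat \<omega>)) \<partial>J)"
proof -
  let ?B = "response_matrix \<beta> G" and ?C = "laplacian G - 2 *\<^sub>R laplacian Gs"
  define P where "P a x = principal_payoff \<beta> Gs (?B *v a) x" for a x
  have int_P: "integrable J (\<lambda>\<omega>. P (f \<omega>) (fst \<omega>))" if "sq_integrable J f" for f
    unfolding P_def principal_payoff_eq[OF Gs]
    by (intro Bochner_Integration.integrable_diff integrable_minus integrable_mult_right sq_integrable_inner
        sq_integrable_diff sq_integrable_matrix sq_integrable_fst that)
  note err = sq_integrable_diff[OF sq_integrable_fst sq_integrable_xhat]
  have int_q: "integrable J (\<lambda>\<omega>. gap_form \<beta> G Gs (?B *v (fst \<omega> - xhat \<omega>)))"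
    unfolding gap_form_def
    by (intro Bochner_Integration.integrable_diff Bochner_Integration.integrable_add integrable_mult_right
        sq_integrable_inner sq_integrable_matrix err)
  have int_b: "integrable J (\<lambda>\<omega>. (?C *v (?B *v xhat \<omega>)) \<bullet> (?B *v (fst \<omega> - xhat \<omega>)))"
    by (intro sq_integrable_inner sq_integrable_matrix err sq_integrable_xhat)
  have [measurable]: "(\<lambda>x. P x x) \<in> borel_measurable borel"
    unfolding P_def principal_payoff_eq[OF Gs] by measurable
  have "(\<integral>x. P x x \<partial>state_law \<mu> \<sigma>) = (\<integral>\<omega>. P (fst \<omega>) (fst \<omega>) \<partial>J)"
    unfolding distr_J_fst[symmetric] by (rule integral_distr) measurable
  then have "(\<integral>x. P x x \<partial>state_law \<mu> \<sigma>) - (\<integral>\<omega>. P (xhat \<omega>) (fst \<omega>) \<partial>J)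
      = (\<integral>\<omega>. P (fst \<omega>) (fst \<omega>) - P (xhat \<omega>) (fst \<omega>) \<partial>J)"
    using Bochner_Integration.integral_diff[OF int_P[OF sq_integrable_fst] int_P[OF sq_integrable_xhat]]
    by simp
  also have "\<dots> = (\<integral>\<omega>. gap_form \<beta> G Gs (?B *v (fst \<omega> - xhat \<omega>))
      + (2 * \<beta>) * ((?C *v (?B *v xhat \<omega>)) \<bullet> (?B *v (fst \<omega> - xhat \<omega>))) \<partial>J)"
    unfolding P_def principal_payoff_diff[OF G Gs \<beta>] ..
  also have "\<dots> = (\<integral>\<omega>. gap_form \<beta> G Gs (?B *v (fst \<omega> - xhat \<omega>)) \<partial>J)
      + (2 * \<beta>) * (\<integral>\<omega>. (?C *v (?B *v xhat \<omega>)) \<bullet> (?B *v (fst \<omega> - xhat \<omega>)) \<partial>J)"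
    using int_q int_b by (simp only: Bochner_Integration.integral_add integrable_mult_right integral_mult_right_zero)
  \<comment> \<open>Transposes collect all matrices on the error, the shape that
    \<open>xhat_orthogonal_matrix\<close> handles.\<close>
  also have "(\<integral>\<omega>. (?C *v (?B *v xhat \<omega>)) \<bullet> (?B *v (fst \<omega> - xhat \<omega>)) \<partial>J)
      = (\<integral>\<omega>. xhat \<omega> \<bullet> ((transpose (?C ** ?B) ** ?B) *v (fst \<omega> - xhat \<omega>)) \<partial>J)"
    by (simp only: matrix_vector_mul_assoc[symmetric] dot_lmul_matrix[symmetric] vector_transpose_matrix
        transpose_transpose)
  also have "\<dots> = 0" by (rule xhat_orthogonal_matrix)
  finally show ?thesis by (simp add: P_def signal_value_def)
qed

end

section \<open>Deterministic signals\<close>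

lemma public_signal_deterministic:
  "f \<in> borel \<rightarrow>\<^sub>M M \<Longrightarrow> public_signal M (\<lambda>x. return M (f x))"
  unfolding public_signal_def by (rule measurable_compose[OF _ measurable_return_prob_space])

locale deterministic_signal =
  fixes \<mu> \<sigma> :: real and M :: "'m measure" and f :: "real ^ 'n \<Rightarrow> 'm"
  assumes \<sigma>: "\<sigma> > 0" and f [measurable]: "f \<in> borel \<rightarrow>\<^sub>M M"
begin

sublocale gaussian_signal \<mu> \<sigma> M "\<lambda>x. return M (f x)"
  by standard (fact \<sigma>, rule public_signal_deterministic[OF f])

lemma joint_law_deterministic: "J = distr (state_law \<mu> \<sigma>) (borel \<Otimes>\<^sub>M M) (\<lambda>x. (x, f x))"
proof -
  have "distr (return M (f x)) (borel \<Otimes>\<^sub>M M) (\<lambda>m. (x, m)) = return (borel \<Otimes>\<^sub>M M) (x, f x)" for x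
    using measurable_space[OF f, of x] by (intro distr_return) simp_all
  then show ?thesis
    unfolding joint_law_def by (subst bind_return_distr'[symmetric]) simp_all
qed


text \<open>The events of \<open>F\<close> are the preimages of message events under
  \<open>snd\<close>; integrals over them become integrals over the state alone.\<close>

lemma integral_J_indicator:
  assumes "C \<in> sets M" "h \<in> borel_measurable borel"
  shows "(\<integral>\<omega>. indicator (snd -` C \<inter> space J) \<omega> * h (fst \<omega>) \<partial>J)
    = (\<integral>x. indicator C (f x) * (h x :: real) \<partial>state_law \<mu> \<sigma>)"
proof -
  have [measurable]: "C \<in> sets M" "h \<in> borel_measurable borel" by fact+
  have "(\<integral>\<omega>. indicator (snd -` C \<inter> space J) \<omega> * h (fst \<omega>) \<partial>J) = (\<integral>\<omega>. indicator C (snd \<omega>) * h (fst \<omega>) \<partial>J)"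
    by (intro Bochner_Integration.integral_cong) (auto simp: indicator_def)
  also have "\<dots> = (\<integral>x. indicator C (f x) * h x \<partial>state_law \<mu> \<sigma>)"
    unfolding joint_law_deterministic by (subst integral_distr) simp_all
  finally show ?thesis .
qed

text \<open>The defining property of conditional expectation, restated in terms of the state law.
  The function \<open>g'\<close> expresses the candidate through the message, which makes it
  \<open>F\<close>-measurable. It agrees with \<open>g\<close> of the state only almost everywhere,
  because \<open>J\<close> is carried by the graph of \<open>f\<close>.\<close>

lemma xhat_deterministic:
  assumes g: "g \<in> borel_measurable borel" "g' \<in> M \<rightarrow>\<^sub>M borel" "\<And>x. g' (f x) = g x"
    and int: "\<And>i. integrable (state_law \<mu> \<sigma>) (\<lambda>x. g x $ i)"
    and eq: "\<And>C i. C \<in> sets M \<Longrightarrow>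
      (\<integral>x. indicator C (f x) * x $ i \<partial>state_law \<mu> \<sigma>) = (\<integral>x. indicator C (f x) * g x $ i \<partial>state_law \<mu> \<sigma>)"
  shows "AE \<omega> in J. xhat \<omega> = g (fst \<omega>)"
proof -
  note [measurable] = g(1,2)
  have m: "(\<lambda>\<omega>. g' (snd \<omega>)) \<in> borel_measurable J" "(\<lambda>\<omega>. g (fst \<omega>)) \<in> borel_measurable J" by measurable
  have "{\<omega> \<in> space J. g' (snd \<omega>) = g (fst \<omega>)} \<in> sets J" using m by measurable
  then have ae: "AE \<omega> in J. g' (snd \<omega>) = g (fst \<omega>)"
    unfolding joint_law_deterministic by (subst AE_distr_iff) (simp_all add: g(3))
  have "AE \<omega> in J. real_cond_exp J F (\<lambda>\<omega>'. fst \<omega>' $ i) \<omega> = g' (snd \<omega>) $ i" for i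
  proof (rule real_cond_exp_charact)
    show "integrable J (\<lambda>\<omega>. fst \<omega> $ i)" by (rule integrable_fst_nth)
    have "integrable J (\<lambda>\<omega>. g (fst \<omega>) $ i)"
      using int[of i] unfolding distr_J_fst[symmetric] by (rule integrable_distr[OF fst_measurable])
    then show "integrable J (\<lambda>\<omega>. g' (snd \<omega>) $ i)"
      by (rule integrable_cong_AE_imp) (use m ae in \<open>auto elim: eventually_mono\<close>)
    have "snd \<in> F \<rightarrow>\<^sub>M M" by (rule measurable_vimage_algebra1) (auto simp: space_J)
    then show "(\<lambda>\<omega>. g' (snd \<omega>) $ i) \<in> borel_measurable F"
      by (rule measurable_compose) measurable
    fix A assume "A \<in> sets F"
    then obtain C where C: "C \<in> sets M" "A = snd -` C \<inter> space J"
      by (subst (asm) sets_vimage_algebra2) (auto simp: space_J)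
    have A: "A \<in> sets J" unfolding C(2) using C(1) by (rule measurable_sets[OF snd_measurable])
    have "(\<integral>\<omega>\<in>A. fst \<omega> $ i \<partial>J) = (\<integral>x. indicator C (f x) * x $ i \<partial>state_law \<mu> \<sigma>)"
      unfolding set_lebesgue_integral_def real_scaleR_def C(2) using C(1)
      by (rule integral_J_indicator) measurable
    also have "\<dots> = (\<integral>x. indicator C (f x) * g x $ i \<partial>state_law \<mu> \<sigma>)" by (rule eq[OF C(1)])
    also have "\<dots> = (\<integral>\<omega>\<in>A. g (fst \<omega>) $ i \<partial>J)"
      unfolding set_lebesgue_integral_def real_scaleR_def C(2) using C(1)
      by (rule integral_J_indicator[symmetric]) measurable
    also have "\<dots> = (\<integral>\<omega>\<in>A. g' (snd \<omega>) $ i \<partial>J)"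
      unfolding set_lebesgue_integral_def using A m ae
      by (intro integral_cong_AE) (auto elim: eventually_mono)
    finally show "(\<integral>\<omega>\<in>A. fst \<omega> $ i \<partial>J) = (\<integral>\<omega>\<in>A. g' (snd \<omega>) $ i \<partial>J)" .
  qed
  then have "AE \<omega> in J. \<forall>i. xhat \<omega> $ i = g' (snd \<omega>) $ i"
    unfolding xhat_nth by (simp add: AE_all_countable)
  with ae show ?thesis by eventually_elim (simp add: vec_eq_iff)
qed

lemma signal_value_deterministic:
  assumes G: "is_graph G" and Gs: "is_graph Gs" and \<beta>: "\<beta> \<ge> 0"
    and xhat: "AE \<omega> in J. xhat \<omega> = g (fst \<omega>)" and [measurable]: "g \<in> borel_measurable borel"
  shows "(\<integral>x. principal_payoff \<beta> Gs (response_matrix \<beta> G *v x) x \<partial>state_law \<mu> \<sigma>)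
      - signal_value \<mu> \<sigma> \<beta> G Gs M (\<lambda>x. return M (f x))
    = (\<integral>x. gap_form \<beta> G Gs (response_matrix \<beta> G *v (x - g x)) \<partial>state_law \<mu> \<sigma>)"
proof -
  have q: "(\<lambda>c. gap_form \<beta> G Gs (response_matrix \<beta> G *v c)) \<in> borel_measurable borel"
    unfolding gap_form_def by measurable
  have [measurable]: "xhat \<in> borel_measurable J"
    using sq_integrable_xhat by (simp add: sq_integrable_def)
  have "(\<integral>\<omega>. gap_form \<beta> G Gs (response_matrix \<beta> G *v (fst \<omega> - xhat \<omega>)) \<partial>J)
      = (\<integral>\<omega>. gap_form \<beta> G Gs (response_matrix \<beta> G *v (fst \<omega> - g (fst \<omega>))) \<partial>J)"
  proof (rule integral_cong_AE)
    show "(\<lambda>\<omega>. gap_form \<beta> G Gs (response_matrix \<beta> G *v (fst \<omega> - xhat \<omega>))) \<in> borel_measurable J"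
      by (rule measurable_compose[OF _ q]) measurable
    show "(\<lambda>\<omega>. gap_form \<beta> G Gs (response_matrix \<beta> G *v (fst \<omega> - g (fst \<omega>)))) \<in> borel_measurable J"
      by (rule measurable_compose[OF _ q]) measurable
  qed (use xhat in \<open>auto elim: eventually_mono\<close>)
  also have "\<dots> = (\<integral>x. gap_form \<beta> G Gs (response_matrix \<beta> G *v (x - g x)) \<partial>distr J borel fst)"
  proof (rule integral_distr[symmetric, OF fst_measurable])
    show "(\<lambda>x. gap_form \<beta> G Gs (response_matrix \<beta> G *v (x - g x))) \<in> borel_measurable borel"
      by (rule measurable_compose[OF _ q]) measurable
  qed
  finally show ?thesis
    unfolding signal_value_gap[OF G Gs \<beta>] distr_J_fst .
qed

end

section \<open>Pooling along a direction\<close>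

text \<open>Exhibits a state direction to which the agents respond by a prescribed
  \<open>c\<close>.\<close>

lemma response_matrix_left:
  fixes c :: "real ^ 'n"
  assumes "is_graph G" "\<beta> \<ge> 0"
  shows "response_matrix \<beta> G *v (c + \<beta> *\<^sub>R (laplacian G *v c)) = c"
proof -
  let ?A = "mat 1 + \<beta> *\<^sub>R laplacian G"
  have A: "c + \<beta> *\<^sub>R (laplacian G *v c) = ?A *v c"
    by (simp only: matrix_vector_mult_add_rdistrib matrix_vector_mul_lid scaleR_matrix_vector_assoc)
  have "matrix_inv ?A ** ?A = mat 1"
    using someI_ex[OF invertible_response[OF assms, unfolded invertible_def]]
    unfolding matrix_inv_def by simp
  then show ?thesis
    unfolding A by (simp only: response_matrix_def matrix_vector_mul_assoc matrix_vector_mul_lid)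
qed

lemma sq_integrable_state_law:
  assumes "\<sigma> > 0"
  shows "sq_integrable (state_law \<mu> \<sigma> :: (real ^ 'n) measure) (\<lambda>x. x)"
  by (rule sq_integrable_vec) (simp_all add: integrable_state_law_sq[OF assms])

lemma integrable_state_law_nth:
  assumes "\<sigma> > 0"
  shows "integrable (state_law \<mu> \<sigma> :: (real ^ 'n) measure) (\<lambda>x. x $ i)"
proof -
  interpret prob_space "state_law \<mu> \<sigma> :: (real ^ 'n) measure" by (rule prob_space_state_law[OF assms])
  have "sq_integrable (state_law \<mu> \<sigma> :: (real ^ 'n) measure) (\<lambda>x. 1 :: real)"
    by (simp add: sq_integrable_def)
  from sq_integrable_inner[OF sq_integrable_nth[where i = i, OF sq_integrable_state_law[OF assms]] this]
  show ?thesis by simp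
qed

text \<open>For a unit vector \<open>w\<close>, the orthogonal projection onto the mirror of
  \<open>mean_reflection\<close>: it keeps all of the state except its component along
  \<open>w\<close>, which is set to that of the mean.\<close>

definition mean_projection :: "real \<Rightarrow> real ^ 'n \<Rightarrow> real ^ 'n \<Rightarrow> real ^ 'n" where
  "mean_projection \<mu> w x = x - ((x - \<mu> *\<^sub>R 1) \<bullet> w) *\<^sub>R w"

lemma measurable_mean_projection [measurable]: "mean_projection \<mu> w \<in> borel_measurable borel"
  unfolding mean_projection_def by measurable

lemma mean_projection_average:
  "mean_projection \<mu> w x = (1 / 2) *\<^sub>R x + (1 / 2) *\<^sub>R mean_reflection \<mu> w x"
  by (simp add: mean_projection_def mean_reflection_def vec_eq_iff algebra_simps)

lemma mean_projection_reflection: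
  assumes "norm w = 1"
  shows "mean_projection \<mu> w (mean_reflection \<mu> w x) = mean_projection \<mu> w x"
proof -
  have "w \<bullet> w = 1" using assms by (simp add: norm_eq_1)
  then show ?thesis
    by (simp add: mean_projection_def mean_reflection_def vec_eq_iff inner_diff_left algebra_simps)
qed

text \<open>The state and its mirror image have the same law and the same projection, so their
  integrals agree on every event decided by the projection. Their midpoint is the projection, whose
  integral is therefore the same as well.\<close>

lemma state_law_mean_projection:
  fixes w :: "real ^ 'n"
  assumes \<sigma>: "\<sigma> > 0" and w: "norm w = 1" and D: "D \<in> sets borel"
  shows "integrable (state_law \<mu> \<sigma>) (\<lambda>x. mean_projection \<mu> w x $ i)"
    and "(\<integral>x. indicator D (mean_projection \<mu> w x) * x $ i \<partial>state_law \<mu> \<sigma>)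
      = (\<integral>x. indicator D (mean_projection \<mu> w x) * mean_projection \<mu> w x $ i \<partial>state_law \<mu> \<sigma>)"
proof -
  let ?S = "state_law \<mu> \<sigma> :: (real ^ 'n) measure" and ?R = "mean_reflection \<mu> w" and ?P = "mean_projection \<mu> w"
  note [measurable] = D
  let ?h = "\<lambda>x. indicator D (?P x) :: real"
  note i1 = integrable_state_law_nth[OF \<sigma>, of \<mu> i]
  have R: "?R \<in> borel_measurable ?S" by measurable
  have i2: "integrable ?S (\<lambda>x. ?R x $ i)"
    by (rule integrable_distr[OF R]) (simp add: distr_state_law_mean_reflection[OF w] i1)
  show "integrable ?S (\<lambda>x. ?P x $ i)"
    using i1 i2 by (simp add: mean_projection_average)
  have ind: "integrable ?S (\<lambda>x. ?h x * f x)" if "integrable ?S f" for f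
    using integrable_mult_indicator[OF _ that, of "?P -` D"] measurable_sets_borel[OF measurable_mean_projection D]
    by (simp add: indicator_def of_bool_def[symmetric] cong: if_cong)
  \<comment> \<open>The indicator is unchanged by the reflection, so the whole integrand is a
    function of \<open>?R x\<close> and the invariance of the law applies.\<close>
  have "(\<integral>x. ?h x * ?R x $ i \<partial>?S) = (\<integral>x. ?h (?R x) * ?R x $ i \<partial>?S)"
    by (simp only: mean_projection_reflection[OF w])
  also have "\<dots> = (\<integral>x. ?h x * x $ i \<partial>distr ?S borel ?R)"
    by (rule integral_distr[symmetric, OF R]) measurable
  also have "\<dots> = (\<integral>x. ?h x * x $ i \<partial>?S)" by (simp only: distr_state_law_mean_reflection[OF w])
  finally have sym: "(\<integral>x. ?h x * ?R x $ i \<partial>?S) = (\<integral>x. ?h x * x $ i \<partial>?S)" .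
  have "(\<integral>x. ?h x * ?P x $ i \<partial>?S) = (\<integral>x. (1 / 2) * (?h x * x $ i) + (1 / 2) * (?h x * ?R x $ i) \<partial>?S)"
    by (intro Bochner_Integration.integral_cong refl) (simp add: mean_projection_average algebra_simps)
  also have "\<dots> = (1 / 2) * (\<integral>x. ?h x * x $ i \<partial>?S) + (1 / 2) * (\<integral>x. ?h x * ?R x $ i \<partial>?S)"
    using ind[OF i1] ind[OF i2]
    by (simp only: Bochner_Integration.integral_add integrable_mult_right integral_mult_right_zero)
  finally show "(\<integral>x. ?h x * x $ i \<partial>?S) = (\<integral>x. ?h x * ?P x $ i \<partial>?S)" by (simp add: sym)
qed

text \<open>A nonnegative integrand with zero integral vanishes almost everywhere, whereas this one
  vanishes only on a null hyperplane.\<close>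

lemma state_law_variance_pos:
  fixes w :: "real ^ 'n"
  assumes \<sigma>: "\<sigma> > 0" and w: "norm w = 1"
  shows "(\<integral>x. ((x - \<mu> *\<^sub>R 1) \<bullet> w)\<^sup>2 \<partial>state_law \<mu> \<sigma>) > 0"
proof -
  let ?S = "state_law \<mu> \<sigma> :: (real ^ 'n) measure"
  interpret prob_space ?S by (rule prob_space_state_law[OF \<sigma>])
  have "sq_integrable ?S (\<lambda>x. \<mu> *\<^sub>R 1 :: real ^ 'n)" by (simp add: sq_integrable_def)
  from sq_integrable_diff[OF sq_integrable_state_law[OF \<sigma>] this]
  have "sq_integrable ?S (\<lambda>x. (x - \<mu> *\<^sub>R 1) \<bullet> w)"
    by (rule sq_integrable_bound[of _ _ _ 1]) (use w Cauchy_Schwarz_ineq2[of _ w] in simp_all)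
  then have int: "integrable ?S (\<lambda>x. ((x - \<mu> *\<^sub>R 1) \<bullet> w)\<^sup>2)" by (simp add: sq_integrable_def)
  have "\<not> (AE x in ?S. ((x - \<mu> *\<^sub>R 1) \<bullet> w)\<^sup>2 = 0)"
  proof
    assume "AE x in ?S. ((x - \<mu> *\<^sub>R 1) \<bullet> w)\<^sup>2 = 0"
    moreover have "w \<noteq> 0" using w by auto
    from AE_state_law_hyperplane[OF this, where \<mu> = \<mu> and \<sigma> = \<sigma> and b = "\<mu> * (1 \<bullet> w)"]
    have "AE x in ?S. w \<bullet> x \<noteq> \<mu> * (1 \<bullet> w)" .
    ultimately have "AE x in ?S. False"
      by eventually_elim (simp add: inner_diff_left inner_commute[of w])
    then show False by simp
  qed
  then have "(\<integral>x. ((x - \<mu> *\<^sub>R 1) \<bullet> w)\<^sup>2 \<partial>?S) \<noteq> 0"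
    by (subst integral_nonneg_eq_0_iff_AE[OF int]) simp_all
  moreover have "(\<integral>x. ((x - \<mu> *\<^sub>R 1) \<bullet> w)\<^sup>2 \<partial>?S) \<ge> 0" by simp
  ultimately show ?thesis by linarith
qed

section \<open>Value and optimality of full revelation\<close>

text \<open>Here \<open>xhat_deterministic\<close> applies with the identity for both
  \<open>g\<close> and \<open>g'\<close>; the error is zero and so is the gap.\<close>

lemma signal_value_full_revelation:
  fixes G Gs :: "real ^ 'n ^ 'n"
  assumes \<sigma>: "\<sigma> > 0" and G: "is_graph G" and Gs: "is_graph Gs" and \<beta>: "\<beta> \<ge> 0"
  shows "signal_value \<mu> \<sigma> \<beta> G Gs borel full_revelation
    = (\<integral>x. principal_payoff \<beta> Gs (response_matrix \<beta> G *v x) x \<partial>state_law \<mu> \<sigma>)"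
proof -
  interpret deterministic_signal \<mu> \<sigma> borel "\<lambda>x :: real ^ 'n. x" by standard (fact \<sigma>, simp)
  have full: "full_revelation = (\<lambda>x :: real ^ 'n. return borel x)"
    by (simp add: fun_eq_iff full_revelation_def)
  have "AE \<omega> in J. xhat \<omega> = fst \<omega>"
    by (rule xhat_deterministic[where g' = "\<lambda>x. x"]) (simp_all add: integrable_state_law_nth[OF \<sigma>])
  from signal_value_deterministic[OF G Gs \<beta> this]
  show ?thesis by (simp add: full gap_form_def)
qed

lemma full_revelation_optimal_iff:
  fixes G Gs :: "real ^ 'n ^ 'n"
  assumes \<sigma>: "\<sigma> > 0" and G: "is_graph G" and Gs: "is_graph Gs" and \<beta>: "\<beta> \<ge> 0"
  shows "optimal_signal TYPE((real ^ 'n) + 'm) \<mu> \<sigma> \<beta> G Gs borel full_revelation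
    \<longleftrightarrow> (\<forall>c. gap_form \<beta> G Gs c \<ge> 0)"
proof
  assume nonneg: "\<forall>c. gap_form \<beta> G Gs c \<ge> 0"
  have "full_revelation = (\<lambda>x :: real ^ 'n. return borel x)"
    by (simp add: fun_eq_iff full_revelation_def)
  then have "public_signal borel (full_revelation :: real ^ 'n \<Rightarrow> _)"
    using public_signal_deterministic[of "\<lambda>x :: real ^ 'n. x" borel] by simp
  moreover have "signal_value \<mu> \<sigma> \<beta> G Gs N \<psi> \<le> signal_value \<mu> \<sigma> \<beta> G Gs borel full_revelation"
    if "public_signal N \<psi>" for N :: "((real ^ 'n) + 'm) measure" and \<psi>
  proof -
    interpret gaussian_signal \<mu> \<sigma> N \<psi> by standard (fact \<sigma>, fact that)
    have "(\<integral>\<omega>. gap_form \<beta> G Gs (response_matrix \<beta> G *v (fst \<omega> - xhat \<omega>)) \<partial>J) \<ge> 0"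
      using nonneg by (intro Bochner_Integration.integral_nonneg) simp
    then show ?thesis
      using signal_value_gap[OF G Gs \<beta>] signal_value_full_revelation[OF \<sigma> G Gs \<beta>, of \<mu>] by simp
  qed
  ultimately show "optimal_signal TYPE((real ^ 'n) + 'm) \<mu> \<sigma> \<beta> G Gs borel full_revelation"
    by (simp add: optimal_signal_def)
next
  let ?B = "response_matrix \<beta> G"
  assume opt: "optimal_signal TYPE((real ^ 'n) + 'm) \<mu> \<sigma> \<beta> G Gs borel full_revelation"
  show "\<forall>c. gap_form \<beta> G Gs c \<ge> 0"
  proof (rule ccontr)
    assume "\<not> (\<forall>c. gap_form \<beta> G Gs c \<ge> 0)"
    then obtain c where c: "gap_form \<beta> G Gs c < 0" by (auto simp: not_le)
    \<comment> \<open>The state direction with response \<open>c\<close>; rescaling it to the unit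
      vector \<open>w\<close> multiplies the form by a positive square and keeps it
      negative.\<close>
    define v where "v = c + \<beta> *\<^sub>R (laplacian G *v c)"
    have Bv: "?B *v v = c" unfolding v_def by (rule response_matrix_left[OF G \<beta>])
    have "v \<noteq> 0"
    proof
      assume "v = 0"
      then have "c = 0" using Bv by simp
      then show False using c by (simp add: gap_form_def)
    qed
    define w where "w = (1 / norm v) *\<^sub>R v"
    have w: "norm w = 1" using \<open>v \<noteq> 0\<close> by (simp add: w_def)
    have "gap_form \<beta> G Gs (?B *v w) = (1 / norm v)\<^sup>2 * gap_form \<beta> G Gs c"
      by (simp only: w_def matrix_vector_mult_scaleR Bv gap_form_scaleR)
    also have "\<dots> < 0" using c \<open>v \<noteq> 0\<close> by (intro mult_pos_neg) simp_all
    finally have Bw: "gap_form \<beta> G Gs (?B *v w) < 0" .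
    \<comment> \<open>Projections are tagged with \<open>Inl\<close>, and \<open>N\<close> carries
      the Borel structure over to the tagged copy, so that the pooling signal is among the
      competitors with messages in the sum type.\<close>
    define N :: "((real ^ 'n) + 'm) measure" where "N = vimage_algebra (range Inl) projl borel"
    define f :: "real ^ 'n \<Rightarrow> (real ^ 'n) + 'm" where "f x = Inl (mean_projection \<mu> w x)" for x
    have f: "f \<in> borel \<rightarrow>\<^sub>M N"
      unfolding N_def by (rule measurable_vimage_algebra2) (simp_all add: f_def)
    have projl: "projl \<in> N \<rightarrow>\<^sub>M borel"
      unfolding N_def by (rule measurable_vimage_algebra1) simp
    interpret deterministic_signal \<mu> \<sigma> N f by standard (fact \<sigma>, fact f)
    have "AE \<omega> in J. xhat \<omega> = mean_projection \<mu> w (fst \<omega>)"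
    proof (rule xhat_deterministic[OF measurable_mean_projection projl])
      show "projl (f x) = mean_projection \<mu> w x" for x by (simp add: f_def)
      show "integrable (state_law \<mu> \<sigma>) (\<lambda>x. mean_projection \<mu> w x $ i)" for i
        by (rule state_law_mean_projection(1)[OF \<sigma> w sets.top])
      fix C i assume "C \<in> sets N"
      then obtain D where D: "D \<in> sets borel" "C = projl -` D \<inter> range Inl"
        unfolding N_def by (subst (asm) sets_vimage_algebra2) auto
      have "indicator C (f x) = (indicator D (mean_projection \<mu> w x) :: real)" for x
        by (simp add: D(2) f_def indicator_def)
      then show "(\<integral>x. indicator C (f x) * x $ i \<partial>state_law \<mu> \<sigma>)
          = (\<integral>x. indicator C (f x) * mean_projection \<mu> w x $ i \<partial>state_law \<mu> \<sigma>)"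
        by (simp only: state_law_mean_projection(2)[OF \<sigma> w D(1)])
    qed
    note gap = signal_value_deterministic[OF G Gs \<beta> this measurable_mean_projection]
    \<comment> \<open>The error lies along \<open>w\<close>, so the expected gap is the variance in
      that direction times the negative value
      \<open>gap_form \<beta> G Gs (?B *v w)\<close>.\<close>
    have "gap_form \<beta> G Gs (?B *v (x - mean_projection \<mu> w x))
        = ((x - \<mu> *\<^sub>R 1) \<bullet> w)\<^sup>2 * gap_form \<beta> G Gs (?B *v w)" for x
    proof -
      have "x - mean_projection \<mu> w x = ((x - \<mu> *\<^sub>R 1) \<bullet> w) *\<^sub>R w" by (simp add: mean_projection_def)
      then show ?thesis by (simp only: matrix_vector_mult_scaleR gap_form_scaleR)
    qed
    then have "(\<integral>x. gap_form \<beta> G Gs (?B *v (x - mean_projection \<mu> w x)) \<partial>state_law \<mu> \<sigma>)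
        = (\<integral>x. ((x - \<mu> *\<^sub>R 1) \<bullet> w)\<^sup>2 \<partial>state_law \<mu> \<sigma>) * gap_form \<beta> G Gs (?B *v w)"
      by (simp only: integral_mult_left_zero)
    also have "\<dots> < 0" using state_law_variance_pos[OF \<sigma> w] Bw by (rule mult_pos_neg)
    finally have "signal_value \<mu> \<sigma> \<beta> G Gs borel full_revelation
        < signal_value \<mu> \<sigma> \<beta> G Gs N (\<lambda>x. return N (f x))"
      using gap signal_value_full_revelation[OF \<sigma> G Gs \<beta>, of \<mu>] by simp
    moreover have "signal_value \<mu> \<sigma> \<beta> G Gs N (\<lambda>x. return N (f x))
        \<le> signal_value \<mu> \<sigma> \<beta> G Gs borel full_revelation"
      using opt public_signal_deterministic[OF f] by (simp add: optimal_signal_def)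
    ultimately show False by simp
  qed
qed

theorem corollary2:
  fixes G Gs :: "real ^ 'n ^ 'n" and \<mu> \<sigma> \<beta> :: real
  assumes "CARD('n) \<ge> 2"
    and "\<sigma> > 0"
    and "\<beta> \<ge> 0"
    and "is_graph G"
    and "Gs = complete_adjacency"
  shows "optimal_signal TYPE((real ^ 'n) + 'm) \<mu> \<sigma> \<beta> G Gs borel full_revelation
         \<longleftrightarrow> ereal \<beta> \<le> beta_hat CARD('n) (sorted_eigenvalues (laplacian G) ! 1)"
  unfolding assms(5) full_revelation_optimal_iff[OF assms(2,4) is_graph_complete assms(3)]
  by (rule gap_form_nonneg_iff[OF assms(4,1,3)])

end
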